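(* Let $r,k \geq 1$ and fix an $r$-perfect matching $M$ of $[rk]$. The number of regions of the $r$-extended Shi arrangement $S_k^r$ equals the number of $(r+1)$-spanning trees $T$ on the vertex set $[rk+1]$ with $\mu(T)=M$.
   Context: The $r$-extended Shi arrangement $S_k^r$ is the set of hyperplanes in $\mathbb{R}^k$ given by $x_i - x_j = c$ for $1\le i<j\le k$ and $c\in\{-r+1,-r+2,\dots,r\}$; its regions are the connected components of the complement of the union of these hyperplanes. For $s\ge 2$, an $s$-spanning tree on a vertex set $V$ is a set $E$ of $s$-element subsets of $V$ such that the bipartite incidence graph (vertex classes $V$ and $E$, a hyperedge adjacent exactly to the vertices it contains) is a tree. An $r$-perfect matching of a set is a partition into blocks of size $r$. For an $(r+1)$-spanning tree $T$ on $[rk+1]$, $\mu(T)$ is obtained as follows: delete vertex $rk+1$ from every hyperedge; each hyperedge now of size $r$ becomes a block of $\mu(T)$ and its vertices are called matched; then repeatedly delete all matched vertices from the remaining unused hyperedges, and each that drops to size $r$ becomes a new block whose vertices become matched. This ends with an $r$-perfect matching $\mu(T)$ of $[rk]$ (each hyperedge of $T$ contains exactly one block of it). *)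

theory Defs
  imports "HOL-Analysis.Analysis"
begin

text \<open>
  The space \<open>\<real>\<^sup>k\<close> is \<open>powertop_real {1..k}\<close>: the real functions on \<open>{1..k}\<close> (extended by
  \<open>undefined\<close> elsewhere) with the product topology.
\<close>

definition shi_arrangement :: "nat \<Rightarrow> nat \<Rightarrow> (nat \<Rightarrow> real) set set" where
  "shi_arrangement r k =
     {{x \<in> topspace (powertop_real {1..k}). x i - x j = of_int c} | i j c.
        1 \<le> i \<and> i < j \<and> j \<le> k \<and> c \<in> {- int r + 1..int r}}"

definition regions :: "nat \<Rightarrow> (nat \<Rightarrow> real) set set \<Rightarrow> (nat \<Rightarrow> real) set set" where
  "regions k \<A> =
     connected_components_of
       (subtopology (powertop_real {1..k}) (topspace (powertop_real {1..k}) - \<Union>\<A>))"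

text \<open>
  Simple undirected graphs are given by a vertex set and a set of two-element edges.
  (The predicate \<open>tree\<close> of the AFP entry \<open>Graph_Theory\<close> only excludes directed cycles, and there
  an edge present in both directions is itself a cycle.)
\<close>

definition graph_connected :: "'a set \<Rightarrow> 'a set set \<Rightarrow> bool" where
  "graph_connected W F \<longleftrightarrow> W \<noteq> {} \<and> (\<forall>u\<in>W. \<forall>v\<in>W. (u, v) \<in> {(a, b). {a, b} \<in> F}\<^sup>*)"

definition graph_cycle :: "'a set set \<Rightarrow> 'a list \<Rightarrow> bool" where
  "graph_cycle F xs \<longleftrightarrow>
     3 \<le> length xs \<and> distinct xs \<and>
     (\<forall>i < length xs. {xs ! i, xs ! (Suc i mod length xs)} \<in> F)"

definition graph_tree :: "'a set \<Rightarrow> 'a set set \<Rightarrow> bool" where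
  "graph_tree W F \<longleftrightarrow> graph_connected W F \<and> (\<nexists>xs. graph_cycle F xs)"

definition incidence_edges :: "'a set \<Rightarrow> 'a set set \<Rightarrow> ('a + 'a set) set set" where
  "incidence_edges V E = {{Inl v, Inr e} | v e. v \<in> V \<and> e \<in> E \<and> v \<in> e}"

definition hyper_spanning_tree :: "nat \<Rightarrow> 'a set \<Rightarrow> 'a set set \<Rightarrow> bool" where
  "hyper_spanning_tree s V E \<longleftrightarrow>
     (\<forall>e\<in>E. e \<subseteq> V \<and> card e = s) \<and> graph_tree (V <+> E) (incidence_edges V E)"

definition perfect_matching :: "nat \<Rightarrow> 'a set \<Rightarrow> 'a set set \<Rightarrow> bool" where
  "perfect_matching r A M \<longleftrightarrow> partition_on A M \<and> (\<forall>b\<in>M. card b = r)"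

text \<open>
  A state \<open>(U, B)\<close> of the matching procedure consists of the unused hyperedges \<open>U\<close> (kept in their
  original form) and the blocks \<open>B\<close> found so far. At that point the vertices deleted from the
  members of \<open>U\<close> are the root \<open>v\<close> and the matched vertices \<open>\<Union>B\<close>.
\<close>

definition matching_step ::
    "nat \<Rightarrow> 'a \<Rightarrow> 'a set set \<times> 'a set set \<Rightarrow> 'a set set \<times> 'a set set" where
  "matching_step r v = (\<lambda>(U, B).
     let D = insert v (\<Union>B); W = {e \<in> U. card (e - D) = r}
     in (U - W, B \<union> (\<lambda>e. e - D) ` W))"

text \<open>
  The second components of the iterates increase; for finite \<open>T\<close> they become stationary, and their
  union is the set of blocks when the procedure ends.
\<close>

definition tree_matching :: "nat \<Rightarrow> 'a \<Rightarrow> 'a set set \<Rightarrow> 'a set set" where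
  "tree_matching r v T = (\<Union>n. snd ((matching_step r v ^^ n) (T, {})))"

end

theory Submission
  imports Defs
begin

text \<open>
  Let the points of \<open>x\<close> be the numbers \<open>x j + c\<close> with \<open>0 \<le> c \<le> r\<close>, and let the slot of \<open>i\<close> be the largest
  point below \<open>x i\<close>. A region has a representative in which no slot is a point \<open>x j + r\<close> with
  \<open>j < i\<close>: such a comparison is not a hyperplane, so \<open>x i\<close> can be moved to the left past that point.
  The slots of this representative determine the region, and the slot maps that occur are exactly
  the injective acyclic ones without such points. Merging each chain of slots \<open>x j + r\<close> into a set of siblings turns
  them into arbitrary acyclic maps that send each \<open>i\<close> to a pair \<open>(j, c)\<close> with \<open>c < r\<close> or to the root.
  If \<open>(j, c)\<close> is read as the \<open>c\<close>-th vertex of the \<open>j\<close>-th block of \<open>M\<close>, such a map attaches each block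
  to a vertex outside of it, and the blocks enlarged by these vertices are the hyperedges of a
  spanning tree with matching \<open>M\<close>; every such tree arises in this way, since one further hyperedge
  would close a cycle.
\<close>

text \<open>The obstacle is the asymmetric range of constants. Up to sign, every comparison of
  \<open>x i\<close> with a point \<open>x l + c\<close>, where \<open>i \<noteq> l\<close> and
  \<open>0 \<le> c \<le> r\<close>, is a hyperplane, except the one with \<open>x j + r\<close> for
  \<open>j < i\<close>. So a region does not fix the order of its points, slots are not an invariant
  of it, and a normal form is needed whose open comparisons are determined by the region.
  Injectivity of the slot maps comes from the offset 0: of two coordinates in one slot, the smaller
  would itself be a point between the slot and the larger. The extra offset \<open>r\<close>,
  allowed only towards a larger index, is exactly what encodes the siblings that injectivity
  forbids: a set of siblings has one increasing order, hence one chain. Neither count is computed;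
  only bijections are composed.\<close>

text \<open>\<open>shi_adm r i l c\<close> says that \<open>x i - x l = c\<close>, for \<open>i \<noteq> l\<close> and \<open>c \<ge> 0\<close>, is a hyperplane of the arrangement.\<close>

definition shi_adm :: "nat \<Rightarrow> nat \<Rightarrow> nat \<Rightarrow> nat \<Rightarrow> bool" where
  "shi_adm r i l c \<longleftrightarrow> c < r \<or> c = r \<and> i < l"

section \<open>Comparison patterns of real vectors\<close>

definition shi_generic :: "nat \<Rightarrow> nat set \<Rightarrow> (nat \<Rightarrow> real) \<Rightarrow> bool" where
  "shi_generic r I x \<longleftrightarrow>
     (\<forall>i\<in>I. \<forall>l\<in>I. \<forall>c. i \<noteq> l \<longrightarrow> shi_adm r i l c \<longrightarrow> x l + real c \<noteq> x i)"

definition shi_agree :: "nat \<Rightarrow> nat set \<Rightarrow> (nat \<Rightarrow> real) \<Rightarrow> (nat \<Rightarrow> real) \<Rightarrow> bool" where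
  "shi_agree r I x y \<longleftrightarrow>
     (\<forall>i\<in>I. \<forall>l\<in>I. \<forall>c. shi_adm r i l c \<longrightarrow> (x l + real c < x i \<longleftrightarrow> y l + real c < y i))"

definition full_agree :: "nat \<Rightarrow> nat set \<Rightarrow> (nat \<Rightarrow> real) \<Rightarrow> (nat \<Rightarrow> real) \<Rightarrow> bool" where
  "full_agree r I x y \<longleftrightarrow>
     (\<forall>i\<in>I. \<forall>l\<in>I. \<forall>c\<le>r. x l + real c < x i \<longleftrightarrow> y l + real c < y i)"

definition spread :: "nat \<Rightarrow> nat set \<Rightarrow> (nat \<Rightarrow> real) \<Rightarrow> bool" where
  "spread r I x \<longleftrightarrow> (\<forall>i\<in>I. \<forall>l\<in>I. \<forall>c\<le>r. i \<noteq> l \<longrightarrow> x l + real c \<noteq> x i)"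

text \<open>An open comparison \<open>x j + real r < x i\<close> may hold only if it is forced:
  before \<open>x i\<close> could move left past \<open>x j + real r\<close>, it would have to cross
  an admissible point, that is, a hyperplane.\<close>

definition canonical :: "nat \<Rightarrow> nat set \<Rightarrow> (nat \<Rightarrow> real) \<Rightarrow> bool" where
  "canonical r I x \<longleftrightarrow>
     (\<forall>i\<in>I. \<forall>j\<in>I. j < i \<and> x j + real r < x i \<longrightarrow>
        (\<exists>l\<in>I. \<exists>c. shi_adm r i l c \<and> x j + real r < x l + real c \<and> x l + real c < x i))"

definition is_slot :: "nat \<Rightarrow> nat set \<Rightarrow> (nat \<Rightarrow> real) \<Rightarrow> nat \<Rightarrow> (nat \<times> nat) option \<Rightarrow> bool" where
  "is_slot r I x i p \<longleftrightarrow> (case p of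
     None \<Rightarrow> \<forall>l\<in>I. \<forall>c\<le>r. \<not> x l + real c < x i
   | Some (j, c) \<Rightarrow> j \<in> I \<and> c \<le> r \<and> x j + real c < x i \<and>
       (\<forall>l\<in>I. \<forall>d\<le>r. x l + real d < x i \<longrightarrow> x l + real d \<le> x j + real c))"

lemma full_agree_imp_shi_agree: "full_agree r I x y \<Longrightarrow> shi_agree r I x y"
  by (auto simp: full_agree_def shi_agree_def shi_adm_def)

lemma shi_agreeD:
  "\<lbrakk>shi_agree r I x y; i \<in> I; l \<in> I; shi_adm r i l c\<rbrakk> \<Longrightarrow> x l + real c < x i \<longleftrightarrow> y l + real c < y i"
  by (simp add: shi_agree_def)

lemma shi_agree_sym: "shi_agree r I x y \<Longrightarrow> shi_agree r I y x"
  by (simp add: shi_agree_def)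

lemma shi_agree_trans: "shi_agree r I x y \<Longrightarrow> shi_agree r I y z \<Longrightarrow> shi_agree r I x z"
  by (simp add: shi_agree_def)

lemma full_agreeD:
  "\<lbrakk>full_agree r I x y; i \<in> I; l \<in> I; c \<le> r\<rbrakk> \<Longrightarrow> x l + real c < x i \<longleftrightarrow> y l + real c < y i"
  by (simp add: full_agree_def)

lemma spreadD: "\<lbrakk>spread r I x; i \<in> I; l \<in> I; c \<le> r; i \<noteq> l\<rbrakk> \<Longrightarrow> x l + real c \<noteq> x i"
  by (simp add: spread_def)

lemma spread_points_eq:
  assumes "spread r I x" "l \<in> I" "m \<in> I" "c \<le> r" "d \<le> r" "x l + real c = x m + real d"
  shows "l = m \<and> c = d"
proof (cases "l = m")
  case False
  have le: "c - d \<le> r" "d - c \<le> r" using assms(4,5) by linarith+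
  show ?thesis
  proof (cases "c \<le> d")
    case True
    then show ?thesis using spreadD[of r I x l m "d - c"] le assms False by (simp add: of_nat_diff)
  next
    case 2: False
    then show ?thesis using spreadD[of r I x m l "c - d"] le assms False by (simp add: of_nat_diff)
  qed
qed (use assms in auto)

text \<open>The difference of the two offsets again lies in \<open>0..r\<close>, so comparing two
  points amounts to comparing a coordinate with a point. If \<open>d > c\<close> it is the reverse
  comparison that is available, and \<open>spread\<close> excludes ties.\<close>

lemma full_agree_points_less:
  assumes fa: "full_agree r I x y" and sp: "spread r I x" "spread r I y"
    and "l \<in> I" "m \<in> I" "c \<le> r" "d \<le> r"
  shows "x l + real c < x m + real d \<longleftrightarrow> y l + real c < y m + real d"
proof (cases "d \<le> c")
  case True
  then show ?thesis using full_agreeD[OF fa, of m l "c - d"] assms by (simp add: of_nat_diff algebra_simps)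
next
  case False
  show ?thesis
  proof (cases "l = m")
    case 2: False
    from False have "x m + real (d - c) \<noteq> x l" "y m + real (d - c) \<noteq> y l"
      "x m + real (d - c) < x l \<longleftrightarrow> y m + real (d - c) < y l"
      using full_agreeD[OF fa, of l m "d - c"] spreadD[OF sp(1), of l m "d - c"]
        spreadD[OF sp(2), of l m "d - c"] assms 2 by auto
    with False show ?thesis by (auto simp: of_nat_diff algebra_simps)
  qed simp
qed

section \<open>Canonical representatives\<close>

text \<open>
  Among the points of a region a canonical one has each \<open>x i\<close> pushed to the left as far as the
  hyperplanes allow, so the comparisons which the region leaves open are decided by it minimally.
\<close>

lemma canonical_least:
  assumes fin: "finite I" and can: "canonical r I y" and ag: "shi_agree r I x y"
    and "i \<in> I" "j \<in> I" "j < i" "y j + real r < y i"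
  shows "x j + real r < x i"
  using assms(4-7)
proof (induction "card {l\<in>I. y l < y i}" arbitrary: i rule: less_induct)
  case less
  from can less.prems obtain l c where l: "l \<in> I" "shi_adm r i l c" "y j + real r < y l + real c"
    "y l + real c < y i" unfolding canonical_def by blast
  have "x l + real c < x i" using shi_agreeD[OF ag _ _ l(2)] l less.prems by simp
  \<comment> \<open>For \<open>c > 0\<close> this is a comparison with offset
    \<open>r - c < r\<close>, hence a hyperplane. For \<open>c = 0\<close> it is open only if
    \<open>j < l\<close>, and then it is the claim itself for \<open>l\<close>, which has fewer
    coordinates below it in \<open>y\<close>.\<close>
  moreover have "x j + real r \<le> x l + real c"
  proof (cases "c = 0")
    case True
    then have lt: "y j + real r < y l" using l by simp
    have "y l < y i" using l True by simp
    then have "{m\<in>I. y m < y l} \<subset> {m\<in>I. y m < y i}" using l(1) by auto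
    then have card: "card {m\<in>I. y m < y l} < card {m\<in>I. y m < y i}"
      using fin by (intro psubset_card_mono) auto
    consider "j < l" | "l = j" | "l < j" by linarith
    then have "x j + real r < x l"
    proof cases
      case 1 then show ?thesis using less.hyps[OF card l(1)] less.prems lt by simp
    next
      case 2 then show ?thesis using lt by simp
    next
      case 3
      then show ?thesis using shi_agreeD[OF ag l(1) \<open>j \<in> I\<close>, of r] lt by (simp add: shi_adm_def)
    qed
    then show ?thesis by simp
  next
    case False
    then have "shi_adm r l j (r - c)" "c \<le> r" using l(2) by (auto simp: shi_adm_def)
    then show ?thesis using shi_agreeD[OF ag l(1) \<open>j \<in> I\<close>, of "r - c"] l by (simp add: of_nat_diff)
  qed
  ultimately show ?case by simp
qed

text \<open>Minimality, applied in both directions, settles the only comparisons that are not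
  hyperplanes.\<close>

lemma canonical_agree_imp_full_agree:
  assumes "finite I" "canonical r I x" "canonical r I y" "shi_agree r I x y"
  shows "full_agree r I x y"
  unfolding full_agree_def
proof (intro ballI allI impI)
  fix i l c assume il: "i \<in> I" "l \<in> I" "c \<le> r"
  consider "shi_adm r i l c" | "i = l" | "l < i" "c = r" using il by (force simp: shi_adm_def)
  then show "x l + real c < x i \<longleftrightarrow> y l + real c < y i"
  proof cases
    case 1 then show ?thesis using shi_agreeD[OF assms(4)] il by blast
  next
    case 3
    then show ?thesis
      using canonical_least[OF assms(1,3,4) il(1,2)] canonical_least[OF assms(1,2) shi_agree_sym[OF assms(4)] il(1,2)]
      by blast
  qed simp
qed

lemma exists_gap_above:
  fixes x :: "nat \<Rightarrow> real"
  assumes "finite I"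
  shows "\<exists>t>a. \<forall>m\<in>I. \<forall>e\<le>r. x m + real e \<le> a \<or> t < x m + real e"
proof -
  define F where "F = {v \<in> (\<lambda>(m, e). x m + real e) ` (I \<times> {..r}). a < v}"
  have F: "finite F" using assms by (simp add: F_def)
  obtain t where t: "a < t" "\<And>v. v \<in> F \<Longrightarrow> t < v"
  proof (cases "F = {}")
    case True then show ?thesis using that[of "a + 1"] by simp
  next
    case False
    then have "a < Min F" using Min_in[OF F] by (auto simp: F_def)
    then show ?thesis using Min_le[OF F] by (intro that[of "(a + Min F) / 2"]) force+
  qed
  have "x m + real e \<le> a \<or> t < x m + real e" if "m \<in> I" "e \<le> r" for m e
    using t(2)[of "x m + real e"] that by (force simp: F_def)
  with t(1) show ?thesis by blast
qed

lemma spread_insert: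
  assumes "spread r I x" "i \<notin> I" "\<And>m. m \<in> I \<Longrightarrow> x m < t"
    "\<And>m e. \<lbrakk>m \<in> I; e \<le> r\<rbrakk> \<Longrightarrow> x m + real e \<noteq> t"
  shows "spread r (insert i I) (x(i := t))"
  using assms by (fastforce simp: spread_def)

text \<open>Coordinates are inserted in increasing order of \<open>x\<close>. The new one is put
  immediately to the right of the \<open>y\<close>-image of an admissible point below
  \<open>x i\<close>, namely of the one highest in \<open>y\<close>; further left it would be on the
  wrong side of that hyperplane.\<close>

lemma exists_canonical:
  assumes "finite I" "r \<ge> 1" "shi_generic r I x"
  shows "\<exists>y. spread r I y \<and> canonical r I y \<and> shi_agree r I x y"
  using assms(1,3)
proof (induction I rule: finite_ranking_induct[where f = x])
  case empty
  show ?case by (simp add: spread_def canonical_def shi_agree_def)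
next
  case (insert i S)
  show ?case
  proof (cases "i \<in> S \<or> S = {}")
    case True
    then show ?thesis
    proof
      assume "i \<in> S"
      then show ?thesis using insert by (simp add: insert_absorb)
    next
      assume "S = {}"
      then show ?thesis by (intro exI[of _ x]) (simp add: spread_def canonical_def shi_agree_def)
    qed
  next
    case False
    then have i: "i \<notin> S" and ne: "S \<noteq> {}" by auto
    from insert.prems have gS: "shi_generic r S x" by (auto simp: shi_generic_def)
    from insert.IH[OF gS] obtain y
      where sp: "spread r S y" and can: "canonical r S y" and ag: "shi_agree r S x y" by blast
    have gen: "x l + real c \<noteq> x i" if "l \<in> S" "shi_adm r i l c" for l c
      using insert.prems that i by (auto simp: shi_generic_def)
    have big: "x l < x i" if "l \<in> S" for l
      using gen[OF that, of 0] insert.hyps(2)[OF that] \<open>r \<ge> 1\<close> by (simp add: shi_adm_def)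
    define Lo where "Lo = {(l, c) \<in> S \<times> {..r}. shi_adm r i l c \<and> x l + real c < x i}"
    define w where "w = (\<lambda>(l, c). y l + real c)"
    have Lo0: "(l, 0) \<in> Lo" if "l \<in> S" for l
      using that big \<open>r \<ge> 1\<close> by (auto simp: Lo_def shi_adm_def)
    have "finite Lo" by (rule finite_subset[of _ "S \<times> {..r}"]) (use insert.hyps in \<open>auto simp: Lo_def\<close>)
    then have finw: "finite (w ` Lo)" by simp
    have wne: "w ` Lo \<noteq> {}" using ne Lo0 by auto
    define a where "a = Max (w ` Lo)"
    have le_a: "y l + real c \<le> a" if "(l, c) \<in> Lo" for l c
    proof -
      have "w (l, c) \<le> a" unfolding a_def by (rule Max_ge[OF finw imageI[OF that]])
      then show ?thesis by (simp add: w_def)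
    qed
    from Max_in[OF finw wne] obtain l0 c0 where l0: "(l0, c0) \<in> Lo" "a = y l0 + real c0"
      by (auto simp: a_def w_def)
    then have l0': "l0 \<in> S" "c0 \<le> r" "shi_adm r i l0 c0" "x l0 + real c0 < x i" by (auto simp: Lo_def)
    \<comment> \<open>There is room for \<open>i\<close> only if no admissible point above
      \<open>x i\<close> has dropped to \<open>a\<close> or below in \<open>y\<close>. The order of
      the two points is a hyperplane comparison, except for \<open>m + r\<close> against
      \<open>l0\<close> with \<open>m < l0\<close>; there \<open>canonical_least\<close> helps,
      since \<open>y\<close> makes this comparison true only if \<open>x\<close> does.\<close>
    have key: "a < y m + real d" if m: "m \<in> S" "shi_adm r i m d" "x i < x m + real d" for m d
    proof (cases "m = l0")
      case True
      then show ?thesis using m l0 l0' by simp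
    next
      case False
      have d: "d \<le> r" using m by (auto simp: shi_adm_def)
      have lt: "x l0 + real c0 < x m + real d" using l0' m by simp
      show ?thesis
      proof (cases "d \<le> c0")
        case True
        have "d \<noteq> 0" using big[OF m(1)] m(3) by (intro notI) simp
        then have "shi_adm r m l0 (c0 - d)" using True l0' by (auto simp: shi_adm_def)
        then show ?thesis
          using shi_agreeD[OF ag m(1) l0'(1)] lt True l0(2) by (fastforce simp: of_nat_diff algebra_simps)
      next
        case 2: False
        have neq: "y m + real (d - c0) \<noteq> y l0" using spreadD[OF sp l0'(1) m(1), of "d - c0"] d False by simp
        have nx: "\<not> x m + real (d - c0) < x l0" using lt 2 by (simp add: of_nat_diff)
        have "\<not> y m + real (d - c0) < y l0"
        proof (cases "shi_adm r l0 m (d - c0)")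
          case True
          then show ?thesis using shi_agreeD[OF ag l0'(1) m(1) True] nx by simp
        next
          case 3: False
          then have "d - c0 = r" "m < l0" using d False 2 by (auto simp: shi_adm_def)
          then show ?thesis using canonical_least[OF insert.hyps(1) can ag l0'(1) m(1)] nx by auto
        qed
        with neq show ?thesis using 2 l0(2) by (simp add: of_nat_diff)
      qed
    qed
    \<comment> \<open>No point of \<open>y\<close> lies between \<open>a\<close> and
      \<open>t\<close>, so a point is below \<open>t\<close> exactly if it is at most
      \<open>a\<close>.\<close>
    from exists_gap_above[OF insert.hyps(1), of a r y] obtain t where t: "a < t"
      and gap: "\<And>m e. m \<in> S \<Longrightarrow> e \<le> r \<Longrightarrow> y m + real e \<le> a \<or> t < y m + real e" by blast
    have yt: "y m < t" if "m \<in> S" for m using le_a[OF Lo0[OF that]] t by simp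
    define z where "z = y(i := t)"
    have zi: "z i = t" by (simp add: z_def)
    have zS: "z m = y m" if "m \<in> S" for m using that i by (auto simp: z_def)
    have "spread r (insert i S) z"
      unfolding z_def using sp i yt gap t by (intro spread_insert) force+
    moreover have "canonical r (insert i S) z"
      unfolding canonical_def
    proof (intro ballI impI, elim conjE)
      fix i' j assume ij: "i' \<in> insert i S" "j \<in> insert i S" "j < i'" "z j + real r < z i'"
      show "\<exists>l\<in>insert i S. \<exists>c. shi_adm r i' l c \<and> z j + real r < z l + real c \<and> z l + real c < z i'"
      proof (cases "i' = i")
        case True
        then have j: "j \<in> S" using ij by auto
        have "y j + real r \<le> a" using gap[OF j, of r] ij True by (simp add: zi zS[OF j])
        moreover have "y j + real r \<noteq> a"
        proof
          assume "y j + real r = a"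
          then have "j = l0 \<and> r = c0"
            using spread_points_eq[OF sp j l0'(1) order_refl l0'(2)] l0(2) by simp
          then show False using l0'(3) ij True by (simp add: shi_adm_def)
        qed
        ultimately show ?thesis using l0' l0(2) t True
          by (intro bexI[of _ l0] exI[of _ c0]) (auto simp: zi zS j)
      next
        case False
        then have i': "i' \<in> S" using ij by auto
        have j: "j \<in> S"
        proof (rule ccontr)
          assume "j \<notin> S"
          then have "j = i" using ij by auto
          then show False using ij(4) yt[OF i'] by (simp add: zi zS[OF i'])
        qed
        from can i' j ij obtain l c where "l \<in> S" "shi_adm r i' l c" "y j + real r < y l + real c"
            "y l + real c < y i'"
          unfolding canonical_def zS[OF i'] zS[OF j] by blast
        then show ?thesis using zS i' j by (intro bexI[of _ l] exI[of _ c]) auto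
      qed
    qed
    moreover have "shi_agree r (insert i S) x z"
      unfolding shi_agree_def
    proof (intro ballI allI impI)
      fix i' l c assume il: "i' \<in> insert i S" "l \<in> insert i S" "shi_adm r i' l c"
      have c: "c \<le> r" using il by (auto simp: shi_adm_def)
      consider "i' = l" | "i' = i" "l \<in> S" | "l = i" "i' \<in> S" | "l \<in> S" "i' \<in> S" using il by blast
      then show "x l + real c < x i' \<longleftrightarrow> z l + real c < z i'"
      proof cases
        case 2
        show ?thesis
        proof
          assume "x l + real c < x i'"
          then have "(l, c) \<in> Lo" using 2 il c by (simp add: Lo_def)
          then show "z l + real c < z i'" using le_a t 2 by (fastforce simp: zi zS)
        next
          assume "z l + real c < z i'"
          then have "y l + real c \<le> a" using gap[OF 2(2) c] 2 by (simp add: zi zS)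
          then show "x l + real c < x i'"
            using key[OF 2(2), of c] gen[OF 2(2), of c] il 2 by force
        qed
      next
        case 3
        then show ?thesis using big[OF 3(2)] yt[OF 3(2)] by (simp add: zi zS)
      next
        case 4
        then show ?thesis using shi_agreeD[OF ag 4(2,1) il(3)] by (simp add: zS)
      qed simp
    qed
    ultimately show ?thesis by blast
  qed
qed

section \<open>Slots\<close>

lemma is_slotD_Some:
  assumes "is_slot r I x i (Some (j, c))"
  shows "j \<in> I" "c \<le> r" "x j + real c < x i"
    "\<And>l d. \<lbrakk>l \<in> I; d \<le> r; x l + real d < x i\<rbrakk> \<Longrightarrow> x l + real d \<le> x j + real c"
  using assms by (auto simp: is_slot_def)

lemma is_slotD_None:
  "\<lbrakk>is_slot r I x i None; l \<in> I; c \<le> r\<rbrakk> \<Longrightarrow> \<not> x l + real c < x i"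
  by (simp add: is_slot_def)

lemma is_slot_unique:
  assumes "spread r I x" "is_slot r I x i p" "is_slot r I x i q"
  shows "p = q"
proof (cases p)
  case None
  show ?thesis
  proof (cases q)
    case (Some b)
    obtain l d where "b = (l, d)" by (cases b)
    then show ?thesis using None Some assms(2) is_slotD_None[of r I x i l d]
      is_slotD_Some[of r I x i l d] assms(3) by auto
  qed (use None in simp)
next
  case (Some a)
  obtain j c where a: "a = (j, c)" by (cases a)
  show ?thesis
  proof (cases q)
    case None
    then show ?thesis using a Some assms(3) is_slotD_None[of r I x i j c]
      is_slotD_Some[of r I x i j c] assms(2) by auto
  next
    case 2: (Some b)
    obtain l d where b: "b = (l, d)" by (cases b)
    note p = is_slotD_Some[OF assms(2)[unfolded Some a]] and q = is_slotD_Some[OF assms(3)[unfolded 2 b]]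
    have "x j + real c = x l + real d" using p(4)[OF q(1-3)] q(4)[OF p(1-3)] by simp
    then show ?thesis using spread_points_eq[OF assms(1) p(1) q(1) p(2) q(2)] Some 2 a b by simp
  qed
qed

text \<open>With offset 0, \<open>x i\<close> is itself a point; below \<open>x i'\<close> it would
  be a higher point than the common slot.\<close>

lemma is_slot_not_less:
  assumes "is_slot r I x i p" "is_slot r I x i' p" "i \<in> I"
  shows "\<not> x i < x i'"
proof
  assume lt: "x i < x i'"
  show False
  proof (cases p)
    case None
    then show ?thesis using is_slotD_None[of r I x i' i 0] assms lt by simp
  next
    case (Some a)
    obtain j c where a: "a = (j, c)" by (cases a)
    note p = is_slotD_Some[OF assms(1)[unfolded Some a]] and q = is_slotD_Some[OF assms(2)[unfolded Some a]]
    show ?thesis using p(3) q(4)[OF assms(3), of 0] lt by simp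
  qed
qed

lemma is_slot_inj:
  assumes "r \<ge> 1" "spread r I x" "is_slot r I x i p" "is_slot r I x i' p" "i \<in> I" "i' \<in> I"
  shows "i = i'"
proof (rule ccontr)
  assume "i \<noteq> i'"
  then have "x i \<noteq> x i'" using spreadD[OF assms(2,6,5), of 0] by simp
  then show False using is_slot_not_less[OF assms(3,4,5)] is_slot_not_less[OF assms(4,3,6)] by linarith
qed

lemma is_slot_exists:
  assumes "finite I"
  shows "\<exists>p. is_slot r I x i p"
proof -
  define L where "L = {(l, c) \<in> I \<times> {..r}. x l + real c < x i}"
  define w where "w = (\<lambda>(l, c). x l + real c)"
  have fin: "finite L" by (rule finite_subset[of _ "I \<times> {..r}"]) (use assms in \<open>auto simp: L_def\<close>)
  show ?thesis
  proof (cases "L = {}")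
    case True
    then have "is_slot r I x i None" by (auto simp: is_slot_def L_def)
    then show ?thesis ..
  next
    case False
    have "Max (w ` L) \<in> w ` L" using fin False by (intro Max_in) auto
    then obtain j c where jc: "(j, c) \<in> L" "Max (w ` L) = w (j, c)" by auto
    have "w p \<le> w (j, c)" if "p \<in> L" for p
      unfolding jc(2)[symmetric] using fin that by (intro Max_ge) auto
    then have "x l + real d \<le> x j + real c" if "l \<in> I" "d \<le> r" "x l + real d < x i" for l d
      using that by (force simp: w_def L_def)
    then have "is_slot r I x i (Some (j, c))" using jc(1) by (simp add: is_slot_def L_def)
    then show ?thesis ..
  qed
qed

lemma full_agree_is_slot:
  assumes fa: "full_agree r I x y" and sp: "spread r I x" "spread r I y"
    and sl: "is_slot r I x i p" and i: "i \<in> I"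
  shows "is_slot r I y i p"
proof (cases p)
  case None
  then show ?thesis using sl full_agreeD[OF fa i] by (simp add: is_slot_def)
next
  case (Some a)
  obtain j c where a: "a = (j, c)" by (cases a)
  note p = is_slotD_Some[OF sl[unfolded Some a]]
  have "y l + real d \<le> y j + real c" if "l \<in> I" "d \<le> r" "y l + real d < y i" for l d
    using p(4)[OF that(1,2)] full_agreeD[OF fa i that(1,2)] that(3)
      full_agree_points_less[OF fa sp p(1) that(1) p(2) that(2)] by linarith
  then show ?thesis using p full_agreeD[OF fa i p(1,2)] by (simp add: Some a is_slot_def)
qed

text \<open>
  In a disagreement \<open>(i, l, c)\<close> with \<open>x i + x l + c\<close> minimal, comparing the slot \<open>(j, d)\<close> of \<open>i\<close> with
  \<open>(l, c)\<close> gives a smaller one: \<open>(j, l, c - d)\<close> or \<open>(l, j, d - c)\<close>.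
\<close>

lemma same_slots_imp_full_agree:
  assumes fin: "finite I" and sp: "spread r I x" "spread r I y"
    and sx: "\<And>i. i \<in> I \<Longrightarrow> is_slot r I x i (s i)" and sy: "\<And>i. i \<in> I \<Longrightarrow> is_slot r I y i (s i)"
  shows "full_agree r I x y"
proof (rule ccontr)
  define Bad where "Bad = {(i, l, c) \<in> I \<times> I \<times> {..r}. (x l + real c < x i) \<noteq> (y l + real c < y i)}"
  define f where "f = (\<lambda>(i, l, c). x i + x l + real c)"
  assume "\<not> full_agree r I x y"
  then have ne: "Bad \<noteq> {}" by (auto simp: full_agree_def Bad_def)
  have finB: "finite Bad"
    by (rule finite_subset[of _ "I \<times> I \<times> {..r}"]) (use fin in \<open>auto simp: Bad_def\<close>)
  obtain i l c where bad: "(i, l, c) \<in> Bad" and min: "\<And>t. t \<in> Bad \<Longrightarrow> f (i, l, c) \<le> f t"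
    using arg_min_if_finite[OF finB ne, of f] by (metis linorder_not_less prod_cases3)
  from bad have I: "i \<in> I" "l \<in> I" "c \<le> r" and ne: "(x l + real c < x i) \<noteq> (y l + real c < y i)"
    by (auto simp: Bad_def)
  have il: "i \<noteq> l" using ne by auto
  have neq: "x l + real c \<noteq> x i" "y l + real c \<noteq> y i"
    using spreadD[OF sp(1) I il] spreadD[OF sp(2) I il] by auto
  have smin: "f (i, l, c) \<le> x i' + x l' + real c'"
    if "i' \<in> I" "l' \<in> I" "c' \<le> r" "(x l' + real c' < x i') \<noteq> (y l' + real c' < y i')" for i' l' c'
    using min[of "(i', l', c')"] that by (simp add: Bad_def f_def)
  obtain j d where jd: "s i = Some (j, d)"
  proof (cases "s i")
    case None
    then show ?thesis using ne is_slotD_None sx[OF I(1)] sy[OF I(1)] I by metis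
  qed auto
  note X = is_slotD_Some[OF sx[OF I(1), unfolded jd]] and Y = is_slotD_Some[OF sy[OF I(1), unfolded jd]]
  \<comment> \<open>In both orders \<open>(j, d)\<close> is the highest point below coordinate
    \<open>i\<close>, so a point other than \<open>(j, d)\<close> is below coordinate
    \<open>i\<close> exactly if it is below \<open>(j, d)\<close>. The disagreement thus passes from
    the coordinate to its slot.\<close>
  have dis: "(x l + real c < x j + real d) \<noteq> (y l + real c < y j + real d)"
  proof -
    have njl: "\<not> (l = j \<and> c = d)" using ne X(3) Y(3) by blast
    have "x l + real c \<noteq> x j + real d" "y l + real c \<noteq> y j + real d"
      using spread_points_eq[OF sp(1) I(2) X(1) I(3) X(2)] spread_points_eq[OF sp(2) I(2) X(1) I(3) X(2)] njl
      by blast+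
    then show ?thesis using X(3) Y(3) X(4)[OF I(2,3)] Y(4)[OF I(2,3)] ne neq by linarith
  qed
  \<comment> \<open>Both alternatives lower \<open>f\<close> because
    \<open>x j + real d < x i\<close>.\<close>
  show False
  proof (cases "d \<le> c")
    case True
    moreover have "c - d \<le> r" using I(3) by linarith
    ultimately show False using smin[of j l "c - d"] dis X I by (simp add: f_def of_nat_diff algebra_simps)
  next
    case False
    have jl: "j \<noteq> l" using dis by auto
    have "x j + real (d - c) \<noteq> x l" "y j + real (d - c) \<noteq> y l"
      using spreadD[OF sp(1) I(2) X(1), of "d - c"] spreadD[OF sp(2) I(2) X(1), of "d - c"] X(2) jl by auto
    then have "(x j + real (d - c) < x l) \<noteq> (y j + real (d - c) < y l)"
      using dis False by (auto simp: of_nat_diff)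
    moreover have "d - c \<le> r" using X(2) by linarith
    ultimately show False using smin[OF I(2) X(1), of "d - c"] X False by (simp add: f_def of_nat_diff)
  qed
qed

section \<open>Realization of slot maps\<close>

text \<open>The existence of a rank \<open>d\<close> expresses acyclicity, and
  \<open>extensional\<close> identifies maps that agree on \<open>I\<close>, so that they can be
  counted.\<close>

definition slot_maps :: "nat \<Rightarrow> nat set \<Rightarrow> (nat \<Rightarrow> (nat \<times> nat) option) set" where
  "slot_maps r I = {s \<in> extensional I. inj_on s I \<and>
     (\<forall>i\<in>I. \<forall>j c. s i = Some (j, c) \<longrightarrow> j \<in> I \<and> shi_adm r i j c) \<and>
     (\<exists>d :: nat \<Rightarrow> nat. \<forall>i\<in>I. \<forall>j c. s i = Some (j, c) \<longrightarrow> d j < d i)}"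

text \<open>
  The points are placed from left to right: next comes the unplaced one with the leftmost available
  slot, immediately to the right of that slot.
\<close>

lemma slot_map_partial_realization:
  fixes d :: "nat \<Rightarrow> nat"
  assumes fin: "finite I" and inj: "inj_on s I"
    and s: "\<And>i j c. \<lbrakk>i \<in> I; s i = Some (j, c)\<rbrakk> \<Longrightarrow> j \<in> I \<and> c \<le> r \<and> d j < d i"
    and n: "n \<le> card I"
  shows "\<exists>J x. J \<subseteq> I \<and> card J = n \<and> spread r J x \<and> (\<forall>i\<in>J. is_slot r J x i (s i)) \<and>
    (\<forall>m\<in>J. \<forall>i\<in>I - J. s i \<noteq> None \<and> (\<forall>j c. s i = Some (j, c) \<longrightarrow> j \<in> J \<longrightarrow> x m \<le> x j + real c))"
  using n
proof (induction n)
  case 0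
  show ?case by (rule exI[of _ "{}"]) (simp add: spread_def)
next
  case (Suc n)
  then obtain J x where J: "J \<subseteq> I" "card J = n" and sp: "spread r J x"
    and sl: "\<And>i. i \<in> J \<Longrightarrow> is_slot r J x i (s i)"
    and nn: "\<And>m i. m \<in> J \<Longrightarrow> i \<in> I - J \<Longrightarrow> s i \<noteq> None"
    and le: "\<And>m i j c. \<lbrakk>m \<in> J; i \<in> I - J; s i = Some (j, c); j \<in> J\<rbrakk> \<Longrightarrow> x m \<le> x j + real c"
    by (elim meta_impE[OF _ Suc_leD] exE conjE) blast+
  have finJ: "finite J" using J fin finite_subset by blast
  have "I - J \<noteq> {}" using J Suc.prems card_mono[OF finJ, of I] by auto
  \<comment> \<open>The parent of an unplaced index of minimal rank, if there is one, has been
    placed; so there is always a next candidate.\<close>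
  then have "\<exists>i. i \<in> I - J \<and> (\<forall>i'. i' \<in> I - J \<longrightarrow> d i \<le> d i')"
    using ex_has_least_nat[of "\<lambda>i. i \<in> I - J" _ d] by blast
  then obtain i1 where i1: "i1 \<in> I - J" "\<And>i'. i' \<in> I - J \<Longrightarrow> d i1 \<le> d i'" by blast
  have i1J: "j \<in> J" if "s i1 = Some (j, c)" for j c
    using s[of i1 j c] i1(1) i1(2)[of j] that by auto
  show ?case
  \<comment> \<open>The first index placed is the one with slot \<open>None\<close>. By injectivity
    no other index has it, which starts the invariant.\<close>
  proof (cases "J = {}")
    case True
    then have "s i1 = None" using i1J by (cases "s i1") auto
    moreover have "s i \<noteq> None" if "i \<in> I - {i1}" for i
    proof
      assume "s i = None"
      then show False using inj_onD[OF inj, of i i1] i1(1) that \<open>s i1 = None\<close> by auto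
    qed
    ultimately show ?thesis
      using i1 True J(2) by (intro exI[of _ "{i1}"] exI[of _ x]) (auto simp: spread_def is_slot_def)
  next
    case False
    define C where "C = {i \<in> I - J. \<exists>j c. s i = Some (j, c) \<and> j \<in> J}"
    define v where "v i = (case s i of None \<Rightarrow> 0 | Some (j, c) \<Rightarrow> x j + real c)" for i
    have "i1 \<in> C" using nn i1(1) i1J False by (force simp: C_def)
    moreover have "finite C" using fin by (simp add: C_def)
    ultimately obtain i where iC: "i \<in> C" and vmin: "\<And>i'. i' \<in> C \<Longrightarrow> v i \<le> v i'"
      using arg_min_if_finite[of C v] by (metis empty_iff linorder_not_less)
    then obtain j0 c0 where j0: "s i = Some (j0, c0)" "j0 \<in> J" and i: "i \<in> I" "i \<notin> J" by (auto simp: C_def)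
    have c0: "c0 \<le> r" using s[OF i(1) j0(1)] by simp
    define a where "a = x j0 + real c0"
    from exists_gap_above[OF finJ, of a r x] obtain t where t: "a < t"
      and gap: "\<And>m e. m \<in> J \<Longrightarrow> e \<le> r \<Longrightarrow> x m + real e \<le> a \<or> t < x m + real e" by blast
    \<comment> \<open>By the invariant no placed coordinate exceeds an available slot. So
      \<open>i\<close> is put to the right of all placed coordinates, and its points cannot disturb
      their slots.\<close>
    have xt: "x m < t" if "m \<in> J" for m
      using le[OF that _ j0] i t by (simp add: a_def)
    define z where "z = x(i := t)"
    have zi: "z i = t" by (simp add: z_def)
    have zJ: "z m = x m" if "m \<in> J" for m using that i by (auto simp: z_def)
    let ?J = "insert i J"
    have spz: "spread r ?J z"
      unfolding z_def using sp i xt gap t by (intro spread_insert) force+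
    have sli: "is_slot r ?J z i (s i)"
      unfolding j0(1) is_slot_def using j0 c0 t gap
      by (auto simp: zi zJ a_def) (metis add.commute not_less_iff_gr_or_eq order.strict_trans1 leI)
    have slm: "is_slot r ?J z m (s m)" if m: "m \<in> J" for m
    proof (cases "s m")
      case None
      then show ?thesis using sl[OF m] xt[OF m] m by (auto simp: is_slot_def zi zJ)
    next
      case (Some b)
      obtain j c where b: "b = (j, c)" by (cases b)
      note p = is_slotD_Some[OF sl[OF m, unfolded Some b]]
      have "z l + real e \<le> x j + real c" if l: "l \<in> ?J" "e \<le> r" "z l + real e < x m" for l e
      proof (cases "l = i")
        case True
        then show ?thesis using l xt[OF m] by (simp add: zi)
      next
        case False
        then show ?thesis using l p(4)[of l e] by (simp add: zJ)
      qed
      then show ?thesis using p m by (simp add: Some b is_slot_def zJ)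
    qed
    have inv: "s i' \<noteq> None \<and> (\<forall>j c. s i' = Some (j, c) \<longrightarrow> j \<in> ?J \<longrightarrow> z m \<le> z j + real c)"
      if m: "m \<in> ?J" and i': "i' \<in> I - ?J" for m i'
    proof (intro conjI allI impI)
      show "s i' \<noteq> None" using nn[of _ i'] False i' by blast
      fix j c assume jc: "s i' = Some (j, c)" "j \<in> ?J"
      have zmt: "z m \<le> t" using m xt by (cases "m = i") (auto simp: zi zJ less_imp_le)
      show "z m \<le> z j + real c"
      proof (cases "j = i")
        case True
        then show ?thesis using zmt by (simp add: zi)
      next
        case 2: False
        then have j: "j \<in> J" using jc by simp
        have c: "c \<le> r" using s[OF _ jc(1)] i' by simp
        have "i' \<in> C" using i' jc j by (simp add: C_def)
        from vmin[OF this] have "a \<le> x j + real c" by (simp add: v_def j0 jc a_def)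
        \<comment> \<open>A tie would give \<open>i\<close> and \<open>i'\<close> the same slot.
          Strictness leaves room for \<open>t\<close> before every other available slot, which
          restores the invariant.\<close>
        moreover have "a \<noteq> x j + real c"
        proof
          assume "a = x j + real c"
          then have "s i = s i'"
            using spread_points_eq[OF sp j0(2) j c0 c] j0(1) jc(1) by (simp add: a_def)
          then show False using inj i i' by (auto dest: inj_onD)
        qed
        ultimately have "t < x j + real c" using gap[OF j c] by simp
        then show ?thesis using zmt j by (simp add: zJ)
      qed
    qed
    show ?thesis
    proof (intro exI conjI)
      show "?J \<subseteq> I" using J i by simp
      show "card ?J = Suc n" using J i finJ by simp
      show "spread r ?J z" by (rule spz)
      show "\<forall>m\<in>?J. is_slot r ?J z m (s m)" using sli slm by blast
      show "\<forall>m\<in>?J. \<forall>i'\<in>I - ?J. s i' \<noteq> None \<and>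
          (\<forall>j c. s i' = Some (j, c) \<longrightarrow> j \<in> ?J \<longrightarrow> z m \<le> z j + real c)"
        using inv by blast
    qed
  qed
qed

lemma slot_map_realization:
  assumes "finite I" "s \<in> slot_maps r I"
  shows "\<exists>x. spread r I x \<and> (\<forall>i\<in>I. is_slot r I x i (s i))"
proof -
  from assms(2) obtain d :: "nat \<Rightarrow> nat" where d: "\<forall>i\<in>I. \<forall>j c. s i = Some (j, c) \<longrightarrow> d j < d i"
    by (auto simp: slot_maps_def)
  have "inj_on s I" using assms(2) by (simp add: slot_maps_def)
  moreover have "j \<in> I \<and> c \<le> r \<and> d j < d i" if "i \<in> I" "s i = Some (j, c)" for i j c
  proof -
    have "j \<in> I" "shi_adm r i j c" using assms(2) that by (auto simp: slot_maps_def)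
    moreover have "d j < d i" using d that by blast
    ultimately show ?thesis by (auto simp: shi_adm_def)
  qed
  ultimately obtain J x where "J \<subseteq> I" "card J = card I" "spread r J x" "\<forall>i\<in>J. is_slot r J x i (s i)"
    using slot_map_partial_realization[OF assms(1) _ _ order_refl, of s r d] by blast
  moreover then have "J = I" using assms(1) card_subset_eq by blast
  ultimately show ?thesis by blast
qed

text \<open>The slot of \<open>i\<close> is the blocking point: it is the highest point below
  \<open>x i\<close>, and being admissible it differs from \<open>x j + real r\<close>.\<close>

lemma admissible_slots_imp_canonical:
  assumes sp: "spread r I x" and sl: "\<And>i. i \<in> I \<Longrightarrow> is_slot r I x i (s i)"
    and s: "\<And>i j c. \<lbrakk>i \<in> I; s i = Some (j, c)\<rbrakk> \<Longrightarrow> shi_adm r i j c"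
  shows "canonical r I x"
  unfolding canonical_def
proof (intro ballI impI, elim conjE)
  fix i j assume ij: "i \<in> I" "j \<in> I" "j < i" "x j + real r < x i"
  obtain l c where lc: "s i = Some (l, c)"
  proof (cases "s i")
    case None
    then show ?thesis using is_slotD_None[of r I x i j r] sl[OF ij(1)] ij by simp
  qed auto
  note p = is_slotD_Some[OF sl[OF ij(1), unfolded lc]]
  have "x j + real r \<noteq> x l + real c"
    using spread_points_eq[OF sp ij(2) p(1) order_refl p(2)] s[OF ij(1) lc] ij(3)
    by (auto simp: shi_adm_def)
  with p(4)[OF ij(2) order_refl ij(4)] have "x j + real r < x l + real c" by simp
  then show "\<exists>l\<in>I. \<exists>c. shi_adm r i l c \<and> x j + real r < x l + real c \<and> x l + real c < x i"
    using p s[OF ij(1) lc] by blast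
qed

lemma canonical_slot_map:
  assumes fin: "finite I" and "r \<ge> 1" and sp: "spread r I x" and can: "canonical r I x"
  shows "\<exists>s\<in>slot_maps r I. \<forall>i\<in>I. is_slot r I x i (s i)"
proof -
  define s where "s = restrict (\<lambda>i. SOME p. is_slot r I x i p) I"
  have sl: "is_slot r I x i (s i)" if "i \<in> I" for i
    using someI_ex[OF is_slot_exists[OF fin]] that by (simp add: s_def)
  have inj: "inj_on s I"
    by (rule inj_onI) (metis is_slot_inj[OF \<open>r \<ge> 1\<close> sp] sl)
  have adm: "j \<in> I \<and> shi_adm r i j c" if i: "i \<in> I" and jc: "s i = Some (j, c)" for i j c
  proof -
    note p = is_slotD_Some[OF sl[OF i, unfolded jc]]
    have "shi_adm r i j c"
    proof (rule ccontr)
      assume na: "\<not> ?thesis"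
      have "i \<noteq> j" using p(3) by auto
      with na p(2) have "c = r" "j < i" by (auto simp: shi_adm_def)
      with can i p obtain l e where "l \<in> I" "shi_adm r i l e" "x j + real r < x l + real e" "x l + real e < x i"
        unfolding canonical_def by blast
      then show False using p(4)[of l e] \<open>c = r\<close> by (auto simp: shi_adm_def)
    qed
    then show ?thesis using p(1) by simp
  qed
  \<comment> \<open>A slot belongs to a coordinate further left, so the number of smaller
    coordinates is a rank that witnesses acyclicity.\<close>
  have rank: "card {l\<in>I. x l < x j} < card {l\<in>I. x l < x i}" if "i \<in> I" "s i = Some (j, c)" for i j c
  proof (rule psubset_card_mono)
    note p = is_slotD_Some[OF sl[OF that(1), unfolded that(2)]]
    have "x j < x i" using p(3) by simp
    then show "{l\<in>I. x l < x j} \<subset> {l\<in>I. x l < x i}" using p(1) by auto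
  qed (use fin in simp)
  have "s \<in> extensional I" by (simp add: s_def)
  moreover have "\<exists>d :: nat \<Rightarrow> nat. \<forall>i\<in>I. \<forall>j c. s i = Some (j, c) \<longrightarrow> d j < d i"
    by (rule exI[of _ "\<lambda>i. card {l\<in>I. x l < x i}"]) (use rank in blast)
  ultimately have "s \<in> slot_maps r I"
    unfolding slot_maps_def using inj adm by blast
  then show ?thesis using sl by blast
qed

text \<open>Each \<open>X s\<close> is canonical because its slots are admissible. Canonical points
  of one class agree in all comparisons, so they have the same slots; conversely a generic point can
  be replaced by a canonical one, whose slots determine it up to agreement.\<close>

lemma slot_maps_represent_classes:
  assumes fin: "finite I" and r: "r \<ge> 1"
  shows "\<exists>X. (\<forall>s\<in>slot_maps r I. shi_generic r I (X s)) \<and>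
    (\<forall>s\<in>slot_maps r I. \<forall>s'\<in>slot_maps r I. shi_agree r I (X s) (X s') \<longrightarrow> s = s') \<and>
    (\<forall>x. shi_generic r I x \<longrightarrow> (\<exists>s\<in>slot_maps r I. shi_agree r I x (X s)))"
proof -
  define X where "X s = (SOME x. spread r I x \<and> (\<forall>i\<in>I. is_slot r I x i (s i)))" for s
  have X: "spread r I (X s)" "\<And>i. i \<in> I \<Longrightarrow> is_slot r I (X s) i (s i)" if "s \<in> slot_maps r I" for s
    using someI_ex[OF slot_map_realization[OF fin that]] by (simp_all add: X_def)
  have can: "canonical r I (X s)" if "s \<in> slot_maps r I" for s
    by (rule admissible_slots_imp_canonical[OF X[OF that]]) (use that in \<open>auto simp: slot_maps_def\<close>)
  have "shi_generic r I (X s)" if "s \<in> slot_maps r I" for s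
    using X(1)[OF that] by (auto simp: spread_def shi_generic_def shi_adm_def)
  moreover have "s = s'" if s: "s \<in> slot_maps r I" "s' \<in> slot_maps r I" and "shi_agree r I (X s) (X s')" for s s'
  proof (rule extensionalityI[of _ I])
    show "s \<in> extensional I" "s' \<in> extensional I" using s by (auto simp: slot_maps_def)
    fix i assume i: "i \<in> I"
    have "full_agree r I (X s) (X s')"
      by (rule canonical_agree_imp_full_agree[OF fin can[OF s(1)] can[OF s(2)] that(3)])
    from full_agree_is_slot[OF this X(1)[OF s(1)] X(1)[OF s(2)] X(2)[OF s(1) i] i]
    show "s i = s' i" using is_slot_unique[OF X(1)[OF s(2)]] X(2)[OF s(2) i] by blast
  qed
  moreover have "\<exists>s\<in>slot_maps r I. shi_agree r I x (X s)" if gx: "shi_generic r I x" for x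
  proof -
    from exists_canonical[OF fin r gx] obtain y
      where y: "spread r I y" "canonical r I y" "shi_agree r I x y" by blast
    from canonical_slot_map[OF fin r y(1,2)] obtain s
      where s: "s \<in> slot_maps r I" "\<And>i. i \<in> I \<Longrightarrow> is_slot r I y i (s i)" by blast
    have "full_agree r I y (X s)"
      by (rule same_slots_imp_full_agree[OF fin y(1) X(1)[OF s(1)] s(2) X(2)[OF s(1)]])
    then show ?thesis using s(1) y(3) full_agree_imp_shi_agree shi_agree_trans by blast
  qed
  ultimately show ?thesis by (intro exI[of _ X]) blast
qed

section \<open>Chains of slots and sets of siblings\<close>

definition label_maps :: "nat \<Rightarrow> nat set \<Rightarrow> (nat \<Rightarrow> (nat \<times> nat) option) set" where
  "label_maps r I = {q \<in> extensional I.
     (\<forall>i\<in>I. \<forall>j c. q i = Some (j, c) \<longrightarrow> j \<in> I \<and> c < r) \<and>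
     (\<exists>d :: nat \<Rightarrow> nat. \<forall>i\<in>I. \<forall>j c. q i = Some (j, c) \<longrightarrow> d j < d i)}"

definition later_siblings :: "nat set \<Rightarrow> (nat \<Rightarrow> (nat \<times> nat) option) \<Rightarrow> nat \<Rightarrow> nat set" where
  "later_siblings I q i = {j \<in> I. i < j \<and> q j = q i}"

text \<open>
  The children of a common label \<open>p\<close> become a chain: the largest one keeps the slot \<open>p\<close>, and each other
  one is put behind the last point \<open>(j, r)\<close> of the next larger child \<open>j\<close>.
\<close>

definition chain_siblings :: "nat \<Rightarrow> nat set \<Rightarrow> (nat \<Rightarrow> (nat \<times> nat) option) \<Rightarrow> nat \<Rightarrow> (nat \<times> nat) option" where
  "chain_siblings r I q = (\<lambda>i\<in>I. if later_siblings I q i = {} then q i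
     else Some (Min (later_siblings I q i), r))"

text \<open>The candidate inverse of \<open>chain_siblings\<close>: it climbs a chain of offsets
  \<open>r\<close> up to the slot of its top. The guards make it terminate; they hold on slot maps
  of a finite \<open>I\<close>, where \<open>shi_adm\<close> forces \<open>i < j\<close> at offset
  \<open>r\<close>.\<close>

function chain_top :: "nat \<Rightarrow> nat set \<Rightarrow> (nat \<Rightarrow> (nat \<times> nat) option) \<Rightarrow> nat \<Rightarrow> (nat \<times> nat) option" where
  "chain_top r I s i = (case s i of None \<Rightarrow> None
     | Some (j, c) \<Rightarrow> if c = r \<and> i < j \<and> j \<in> I \<and> finite I then chain_top r I s j else s i)"
  by pat_completeness auto
termination
  by (relation "Wellfounded.measure (\<lambda>(r, I, s, i). card {l\<in>I. i < l})") (auto intro!: psubset_card_mono)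

declare chain_top.simps [simp del]

lemma finite_later_siblings: "finite I \<Longrightarrow> finite (later_siblings I q i)"
  by (simp add: later_siblings_def)

lemma Min_later_siblings:
  assumes "finite I" "later_siblings I q i \<noteq> {}"
  shows "Min (later_siblings I q i) \<in> I" "i < Min (later_siblings I q i)" "q (Min (later_siblings I q i)) = q i"
  using Min_in[OF finite_later_siblings[OF assms(1)] assms(2)] by (auto simp: later_siblings_def)

lemma chain_siblings_eq:
  "i \<in> I \<Longrightarrow> chain_siblings r I q i =
    (if later_siblings I q i = {} then q i else Some (Min (later_siblings I q i), r))"
  by (simp add: chain_siblings_def)

lemma label_mapsD:
  "\<lbrakk>q \<in> label_maps r I; i \<in> I; q i = Some (j, c)\<rbrakk> \<Longrightarrow> j \<in> I \<and> c < r"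
  by (simp add: label_maps_def)

lemma slot_mapsD:
  "\<lbrakk>s \<in> slot_maps r I; i \<in> I; s i = Some (j, c)\<rbrakk> \<Longrightarrow> j \<in> I \<and> shi_adm r i j c"
  by (simp add: slot_maps_def)

text \<open>Injectivity: a label has an offset below \<open>r\<close> and so never equals a chain
  slot; only the largest sibling keeps the label; and a common next sibling makes the two indices
  siblings, the larger of which then precedes that next one.\<close>

lemma chain_siblings_in_slot_maps:
  assumes fin: "finite I" and q: "q \<in> label_maps r I"
  shows "chain_siblings r I q \<in> slot_maps r I"
proof -
  let ?s = "chain_siblings r I q" and ?L = "later_siblings I q"
  note MinL = Min_later_siblings[OF fin, of q]
  have inj_lt: "?s i \<noteq> ?s i'" if i: "i \<in> I" "i' \<in> I" "i < i'" for i i'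
  proof
    assume eq: "?s i = ?s i'"
    have iL: "i' \<in> ?L i" if "q i = q i'" using that i by (simp add: later_siblings_def)
    show False
    proof (cases "?L i = {}")
      case True
      show False
      proof (cases "?L i' = {}")
        case 2: True
        then show False using True eq iL by (simp add: chain_siblings_eq i)
      next
        case False
        then have "q i = Some (Min (?L i'), r)" using True eq by (simp add: chain_siblings_eq i)
        then show False using label_mapsD[OF q i(1)] by fastforce
      qed
    next
      case False
      show False
      proof (cases "?L i' = {}")
        case True
        then have "q i' = Some (Min (?L i), r)" using False eq by (simp add: chain_siblings_eq i)
        then show False using label_mapsD[OF q i(2)] by fastforce
      next
        case 2: False
        then have m: "Min (?L i) = Min (?L i')" using False eq by (simp add: chain_siblings_eq i)
        then have "q i = q i'" using MinL(3)[OF False] MinL(3)[OF 2] by simp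
        then have "Min (?L i) \<le> i'" using iL fin by (simp add: finite_later_siblings)
        then show False using MinL(2)[OF 2] m by simp
      qed
    qed
  qed
  have inj: "inj_on ?s I"
    by (rule inj_onI) (metis inj_lt linorder_neqE_nat)
  from q obtain d :: "nat \<Rightarrow> nat" where d: "\<And>i j c. \<lbrakk>i \<in> I; q i = Some (j, c)\<rbrakk> \<Longrightarrow> d j < d i"
    unfolding label_maps_def by blast
  \<comment> \<open>Siblings may have arbitrary ranks \<open>d\<close>, which need not decrease
    towards the next larger sibling. But \<open>e\<close> depends on the label only, hence is
    constant on siblings, and \<open>d'\<close> orders lexicographically by \<open>e\<close> and
    then by decreasing index; \<open>K\<close> exceeds every index.\<close>
  define e where "e i = (case q i of None \<Rightarrow> 0 | Some (j, c) \<Rightarrow> Suc (d j))" for i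
  have ed: "e i \<le> d i" if "i \<in> I" for i
    using d[OF that] by (auto simp: e_def Suc_le_eq split: option.split)
  define K where "K = Suc (Max I)"
  have K: "i < K" if "i \<in> I" for i using Max_ge[OF fin that] by (simp add: K_def)
  define d' where "d' i = e i * K + (K - i)" for i
  have "j \<in> I \<and> shi_adm r i j c \<and> d' j < d' i" if i: "i \<in> I" and s: "?s i = Some (j, c)" for i j c
  proof (cases "?L i = {}")
    case True
    then have qi: "q i = Some (j, c)" using s i by (simp add: chain_siblings_eq)
    then have j: "j \<in> I" "c < r" using label_mapsD[OF q i] by auto
    have "e j < e i" using ed[OF j(1)] qi by (simp add: e_def)
    then have "Suc (e j) * K \<le> e i * K" by (intro mult_le_mono1) simp
    moreover have "d' j \<le> Suc (e j) * K" by (simp add: d'_def)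
    moreover have "e i * K < d' i" using K[OF i] by (simp add: d'_def)
    ultimately show ?thesis using j by (simp add: shi_adm_def)
  next
    case False
    then have jc: "j = Min (?L i)" "c = r" using s i by (auto simp: chain_siblings_eq)
    then have j: "j \<in> I" "i < j" "q j = q i" using MinL[OF False] by simp_all
    then have "e j = e i" by (simp add: e_def)
    then have "d' j < d' i" using K[OF j(1)] j(2) by (simp add: d'_def)
    then show ?thesis using j jc by (simp add: shi_adm_def)
  qed
  moreover have "?s \<in> extensional I" by (simp add: chain_siblings_def)
  ultimately show ?thesis unfolding slot_maps_def using inj by blast
qed

text \<open>The labels are recovered from the largest index down: offset \<open>r\<close> passes on
  the label of a larger index, and any other slot is the label itself.\<close>

lemma inj_on_chain_siblings:
  assumes fin: "finite I"
  shows "inj_on (chain_siblings r I) (label_maps r I)"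
proof (rule inj_onI)
  fix q q' assume q: "q \<in> label_maps r I" "q' \<in> label_maps r I"
    and eq: "chain_siblings r I q = chain_siblings r I q'"
  have "q i = q' i" if "i \<in> I" for i
    using that
  proof (induction "card {l\<in>I. i < l}" arbitrary: i rule: less_induct)
    case less
    note i = less.prems
    have e: "chain_siblings r I q i = chain_siblings r I q' i" using eq by simp
    show ?case
    proof (cases "later_siblings I q i = {}")
      case True
      show ?thesis
      proof (cases "later_siblings I q' i = {}")
        case 2: True
        then show ?thesis using e True i by (simp add: chain_siblings_eq)
      next
        case False
        then have "q i = Some (Min (later_siblings I q' i), r)" using e True i by (simp add: chain_siblings_eq)
        then show ?thesis using label_mapsD[OF q(1) i] by fastforce
      qed
    next
      case False
      show ?thesis
      proof (cases "later_siblings I q' i = {}")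
        case True
        then have "q' i = Some (Min (later_siblings I q i), r)" using e False i by (simp add: chain_siblings_eq)
        then show ?thesis using label_mapsD[OF q(2) i] by fastforce
      next
        case 2: False
        define m where "m = Min (later_siblings I q i)"
        have m': "m = Min (later_siblings I q' i)"
          using e False 2 i by (simp add: chain_siblings_eq m_def)
        have m: "m \<in> I" "i < m" "q m = q i" using Min_later_siblings[OF fin False] by (simp_all add: m_def)
        have "q' m = q' i" using Min_later_siblings[OF fin 2] by (simp add: m')
        moreover have "card {l\<in>I. m < l} < card {l\<in>I. i < l}"
          using m fin by (intro psubset_card_mono) auto
        ultimately show ?thesis using less.hyps m by metis
      qed
    qed
  qed
  then show "q = q'" using q by (intro extensionalityI[of _ I]) (auto simp: label_maps_def)
qed

text \<open>Every climb ends in a legitimate label. The point to prove is that indices with a common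
  end lie on one chain in increasing order, which is where injectivity of \<open>s\<close>
  enters.\<close>

lemma chain_siblings_surj:
  assumes fin: "finite I" and s: "s \<in> slot_maps r I"
  shows "\<exists>q\<in>label_maps r I. chain_siblings r I q = s"
proof -
  define q where "q = restrict (chain_top r I s) I"
  have q_Some: "q i = q j" if i: "i \<in> I" "s i = Some (j, r)" for i j
    using slot_mapsD[OF s that] i fin
    by (subst (1) q_def) (simp add: chain_top.simps[of r I s i] shi_adm_def q_def)
  have q_other: "q i = s i" if i: "i \<in> I" "\<And>j. s i \<noteq> Some (j, r)" for i
    using that by (auto simp: q_def chain_top.simps[of r I s i] split: option.split)
  have gt: "j \<in> I \<and> i < j" if "i \<in> I" "s i = Some (j, r)" for i j
    using slot_mapsD[OF s that] by (simp add: shi_adm_def)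
  have inj: "i = i'" if "i \<in> I" "i' \<in> I" "s i = s i'" for i i'
    using s that by (auto simp: slot_maps_def dest: inj_onD)
  from s obtain d :: "nat \<Rightarrow> nat" where d: "\<And>i j c. \<lbrakk>i \<in> I; s i = Some (j, c)\<rbrakk> \<Longrightarrow> d j < d i"
    unfolding slot_maps_def by blast
  have smaller: "card {l\<in>I. j < l} < card {l\<in>I. i < l}" if "j \<in> I" "i < j" for i j
    using that fin by (intro psubset_card_mono) auto
  have qd: "j \<in> I \<and> c < r \<and> d j < d i" if "i \<in> I" "q i = Some (j, c)" for i j c
    using that
  proof (induction "card {l\<in>I. i < l}" arbitrary: i rule: less_induct)
    case less
    note i = less.prems
    show ?case
    proof (cases "\<exists>m. s i = Some (m, r)")
      case True
      then obtain m where m: "s i = Some (m, r)" by blast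
      note m' = gt[OF i(1) m]
      have "q m = Some (j, c)" using q_Some[OF i(1) m] i by simp
      then have "j \<in> I \<and> c < r \<and> d j < d m" using less.hyps[OF smaller] m' by blast
      then show ?thesis using d[OF i(1) m] by simp
    next
      case False
      then have "s i = Some (j, c)" using q_other[of i] i by auto
      then show ?thesis using slot_mapsD[OF s i(1)] d[OF i(1)] False by (auto simp: shi_adm_def)
    qed
  qed
  have qL: "q \<in> label_maps r I"
    unfolding label_maps_def using qd by (auto simp: q_def)
  \<comment> \<open>A chain could fail by a second top or by a skipped sibling. In either case the
    largest such index \<open>m\<close> would share its slot with \<open>i\<close>.\<close>
  have next_sibling: "\<exists>j. s i = Some (j, r) \<and> j \<le> i'"
    if "i \<in> I" "i' \<in> I" "i < i'" "q i = q i'" for i i'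
    using that
  proof (induction "card {l\<in>I. i < l}" arbitrary: i i' rule: less_induct)
    case less
    note i = less.prems
    show ?case
    proof (cases "\<exists>j. s i = Some (j, r)")
      case False
      then have qi: "q i = s i" using q_other i by blast
      define A where "A = {m\<in>I. i < m \<and> q m = q i}"
      have A: "finite A" "A \<noteq> {}" using fin i by (auto simp: A_def)
      define m where "m = Max A"
      have m: "m \<in> I" "i < m" "q m = q i" using Max_in[OF A] by (auto simp: m_def A_def)
      have "s m \<noteq> Some (j, r)" for j
      proof
        assume sm: "s m = Some (j, r)"
        then have "j \<in> A" using gt[OF m(1) sm] q_Some[OF m(1) sm] m by (simp add: A_def)
        then have "j \<le> m" using A by (simp add: m_def)
        then show False using gt[OF m(1) sm] by simp
      qed
      then have "s m = s i" using q_other[OF m(1)] m qi by simp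
      then show ?thesis using inj[OF m(1) i(1)] m by simp
    next
      case True
      then obtain j where j: "s i = Some (j, r)" by blast
      note j' = gt[OF i(1) j]
      have "j \<le> i'"
      proof (rule ccontr)
        assume nle: "\<not> j \<le> i'"
        define A where "A = {m\<in>I. i < m \<and> m < j \<and> q m = q i}"
        have "i' \<in> A" using i nle by (simp add: A_def)
        then have A: "finite A" "A \<noteq> {}" using fin by (auto simp: A_def)
        define m where "m = Max A"
        have m: "m \<in> I" "i < m" "m < j" "q m = q i" using Max_in[OF A] by (auto simp: m_def A_def)
        have "q m = q j" using m q_Some[OF i(1) j] by simp
        then obtain l where l: "s m = Some (l, r)" "l \<le> j"
          using less.hyps[OF smaller[OF m(1,2)] m(1) _ m(3)] j' by blast
        have "l \<noteq> j" using inj[OF m(1) i(1)] l j m by auto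
        then have "l \<in> A" using gt[OF m(1) l(1)] q_Some[OF m(1) l(1)] l m by (simp add: A_def)
        then have "l \<le> m" using A by (simp add: m_def)
        then show False using gt[OF m(1) l(1)] by simp
      qed
      then show ?thesis using j by blast
    qed
  qed
  have "chain_siblings r I q i = s i" if i: "i \<in> I" for i
  proof (cases "\<exists>j. s i = Some (j, r)")
    case True
    then obtain j where j: "s i = Some (j, r)" by blast
    have jL: "j \<in> later_siblings I q i"
      using gt[OF i j] q_Some[OF i j] by (simp add: later_siblings_def)
    have "j \<le> l" if "l \<in> later_siblings I q i" for l
      using next_sibling[OF i, of l] that j by (auto simp: later_siblings_def)
    then have "Min (later_siblings I q i) = j"
      by (intro Min_eqI finite_later_siblings fin jL)
    then show ?thesis using i j jL by (auto simp: chain_siblings_eq)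
  next
    case False
    have "later_siblings I q i = {}"
      using next_sibling[OF i] False by (fastforce simp: later_siblings_def)
    then show ?thesis using i q_other[of i] False by (simp add: chain_siblings_eq)
  qed
  then have "chain_siblings r I q = s"
    using s by (intro extensionalityI[of _ I]) (auto simp: chain_siblings_def slot_maps_def)
  with qL show ?thesis by blast
qed

lemma bij_betw_chain_siblings:
  assumes "finite I"
  shows "bij_betw (chain_siblings r I) (label_maps r I) (slot_maps r I)"
  unfolding bij_betw_def
proof (intro conjI inj_on_chain_siblings[OF assms] equalityI subsetI)
  fix s assume "s \<in> chain_siblings r I ` label_maps r I"
  then show "s \<in> slot_maps r I" using chain_siblings_in_slot_maps[OF assms] by auto
next
  fix s assume "s \<in> slot_maps r I"
  then show "s \<in> chain_siblings r I ` label_maps r I" using chain_siblings_surj[OF assms] by blast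
qed

lemma finite_label_maps:
  assumes "finite I"
  shows "finite (label_maps r I)"
proof (rule finite_subset)
  show "label_maps r I \<subseteq> I \<rightarrow>\<^sub>E insert None (Some ` (I \<times> {..<r}))"
  proof
    fix q assume q: "q \<in> label_maps r I"
    have "q i \<in> insert None (Some ` (I \<times> {..<r}))" if "i \<in> I" for i
      using label_mapsD[OF q that] by (cases "q i") auto
    then show "q \<in> I \<rightarrow>\<^sub>E insert None (Some ` (I \<times> {..<r}))"
      using q by (auto simp: label_maps_def PiE_def)
  qed
  show "finite (I \<rightarrow>\<^sub>E insert None (Some ` (I \<times> {..<r})))"
    using assms by (intro finite_PiE) auto
qed

section \<open>Cycles and paths in graphs\<close>

text \<open>At a vertex of maximal rank on the cycle, both neighbours would have to be its
  parent.\<close>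

lemma no_graph_cycle_if_parent:
  fixes rk :: "'a \<Rightarrow> nat"
  assumes par: "\<And>x y. {x, y} \<in> F \<Longrightarrow> (y = par x \<and> rk y < rk x) \<or> (x = par y \<and> rk x < rk y)"
  shows "\<not> graph_cycle F xs"
proof
  assume "graph_cycle F xs"
  then have len: "3 \<le> length xs" and dist: "distinct xs"
    and adj: "\<And>i. i < length xs \<Longrightarrow> {xs ! i, xs ! (Suc i mod length xs)} \<in> F"
    by (auto simp: graph_cycle_def)
  define n where "n = length xs"
  obtain m where m: "m < n" "\<And>i. i < n \<Longrightarrow> rk (xs ! i) \<le> rk (xs ! m)"
  proof -
    have "finite ((\<lambda>i. rk (xs ! i)) ` {..<n})" "(\<lambda>i. rk (xs ! i)) ` {..<n} \<noteq> {}"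
      using len by (auto simp: n_def lessThan_empty_iff)
    from Max_in[OF this] Max_ge[OF this(1)] that show ?thesis
      by (smt (verit, best) imageE image_eqI lessThan_iff)
  qed
  have up: "y = par (xs ! m)" if "{xs ! m, y} \<in> F" "y \<in> set xs" for y
    using par[OF that(1)] m(2) that(2) by (metis in_set_conv_nth leD n_def)
  \<comment> \<open>The cyclic predecessor of \<open>m\<close>; it differs from the successor
    because the length is at least 3.\<close>
  define p where "p = (if m = 0 then n - 1 else m - 1)"
  have p: "p < n" "Suc p mod n = m" "p \<noteq> Suc m mod n"
    using m(1) len by (auto simp: p_def n_def mod_Suc)
  have s: "Suc m mod n < n" using m(1) by simp
  have "xs ! (Suc m mod n) = par (xs ! m)"
    using up adj[of m] m(1) s by (auto simp: n_def)
  moreover have "xs ! p = par (xs ! m)"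
    using up[of "xs ! p"] adj[of p] p by (auto simp: n_def insert_commute)
  ultimately show False
    using dist p s nth_eq_iff_index_eq unfolding n_def by metis
qed

text \<open>Reachability yields walks only, whereas \<open>graph_cycle\<close> demands distinct
  vertices; a walk that returns to a vertex is cut back to it.\<close>

lemma simple_path_if_reachable:
  assumes "(u, v) \<in> {(a, b). {a, b} \<in> F}\<^sup>*"
  shows "\<exists>xs. xs \<noteq> [] \<and> hd xs = u \<and> last xs = v \<and> distinct xs \<and>
    successively (\<lambda>a b. {a, b} \<in> F) xs"
  using assms
proof (induction rule: rtrancl_induct)
  case base
  show ?case by (rule exI[of _ "[u]"]) auto
next
  case (step y z)
  then obtain xs where xs: "xs \<noteq> []" "hd xs = u" "last xs = y" "distinct xs"
    "successively (\<lambda>a b. {a, b} \<in> F) xs" by blast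
  show ?case
  proof (cases "z \<in> set xs")
    case True
    then obtain as bs where ab: "xs = as @ z # bs" by (auto simp: in_set_conv_decomp)
    show ?thesis
      by (rule exI[of _ "as @ [z]"])
        (use xs ab in \<open>auto simp: successively_append_iff hd_append successively_Cons\<close>)
  next
    case False
    show ?thesis
      by (rule exI[of _ "xs @ [z]"])
        (use xs False step(2) in \<open>auto simp: successively_append_iff\<close>)
  qed
qed

lemma successively_nthD: "successively P xs \<Longrightarrow> Suc i < length xs \<Longrightarrow> P (xs ! i) (xs ! Suc i)"
  by (induction P xs arbitrary: i rule: successively.induct) (auto simp: nth_Cons split: nat.splits)

section \<open>Parent maps of blocks and spanning trees\<close>

text \<open>\<open>p b\<close> is the vertex to which block \<open>b\<close> is attached. The rank
  condition with \<open>b' = b\<close> includes \<open>p b \<notin> b\<close>.\<close>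

definition parent_maps :: "'a set set \<Rightarrow> 'a \<Rightarrow> ('a set \<Rightarrow> 'a) set" where
  "parent_maps M \<rho> = {p \<in> M \<rightarrow>\<^sub>E insert \<rho> (\<Union>M).
     \<exists>d :: 'a set \<Rightarrow> nat. \<forall>b\<in>M. \<forall>b'\<in>M. p b \<in> b' \<longrightarrow> d b' < d b}"

lemma parent_maps_rank:
  "p \<in> parent_maps M \<rho> \<Longrightarrow>
    \<exists>d :: 'a set \<Rightarrow> nat. \<forall>b\<in>M. \<forall>b'\<in>M. p b \<in> b' \<longrightarrow> d b' < d b"
  by (simp add: parent_maps_def)

lemma parent_maps_in: "p \<in> parent_maps M \<rho> \<Longrightarrow> b \<in> M \<Longrightarrow> p b \<in> insert \<rho> (\<Union>M)"
  by (auto simp: parent_maps_def)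

text \<open>This happens only for singletons, that is for \<open>r = 1\<close>, where an edge does
  not show which of its ends is the block.\<close>

lemma insert_eq_insert_disjoint:
  assumes "insert x b = insert y c" "b \<inter> c = {}" "b \<noteq> {}" "c \<noteq> {}"
  shows "x \<in> c \<and> y \<in> b"
proof -
  from \<open>b \<noteq> {}\<close> \<open>c \<noteq> {}\<close> obtain u v where "u \<in> b" "v \<in> c" by auto
  moreover have "u \<in> insert y c" "v \<in> insert x b"
    using \<open>u \<in> b\<close> \<open>v \<in> c\<close> assms(1) by auto
  ultimately show ?thesis using assms(2) by auto
qed

definition parent_tree :: "'a set set \<Rightarrow> ('a set \<Rightarrow> 'a) \<Rightarrow> 'a set set" where
  "parent_tree M p = (\<lambda>b. insert (p b) b) ` M"

lemma inj_on_parent_tree: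
  assumes ne: "{} \<notin> M" and dj: "disjoint M"
  shows "inj_on (parent_tree M) (parent_maps M \<rho>)"
proof (rule inj_onI, rule ccontr)
  fix p p' :: "'a set \<Rightarrow> 'a"
  assume p: "p \<in> parent_maps M \<rho>" and p': "p' \<in> parent_maps M \<rho>"
    and eq: "parent_tree M p = parent_tree M p'" and neq: "p \<noteq> p'"
  from parent_maps_rank[OF p] obtain d :: "'a set \<Rightarrow> nat"
    where "\<forall>b\<in>M. \<forall>b'\<in>M. p b \<in> b' \<longrightarrow> d b' < d b" ..
  then have d: "d b' < d b" if "b \<in> M" "b' \<in> M" "p b \<in> b'" for b b'
    using that by blast
  from parent_maps_rank[OF p'] obtain d' :: "'a set \<Rightarrow> nat"
    where "\<forall>b\<in>M. \<forall>b'\<in>M. p' b \<in> b' \<longrightarrow> d' b' < d' b" ..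
  then have d': "d' b' < d' b" if "b \<in> M" "b' \<in> M" "p' b \<in> b'" for b b'
    using that by blast
  have "\<exists>b. b \<in> M \<and> p b \<noteq> p' b"
  proof (rule ccontr)
    assume "\<not> ?thesis"
    with p p' have "p = p'"
      unfolding parent_maps_def by (intro PiE_ext[of p M _ p']) auto
    with neq show False by simp
  qed
  \<comment> \<open>If the hyperedge of \<open>b\<close> belongs to another block \<open>c\<close>
    under \<open>p'\<close>, the two are attached to each other crosswise. Minimality of
    \<open>b\<close> then makes \<open>p\<close> and \<open>p'\<close> agree at the lower block
    \<open>c\<close>, so \<open>p\<close> itself attaches \<open>c\<close> to \<open>b\<close> and
    \<open>b\<close> to \<open>c\<close>.\<close>
  then have "\<exists>b. (b \<in> M \<and> p b \<noteq> p' b) \<and> (\<forall>c. c \<in> M \<and> p c \<noteq> p' c \<longrightarrow> d b \<le> d c)"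
    by (elim exE) (rule ex_has_least_nat)
  then obtain b where b: "b \<in> M" "p b \<noteq> p' b" and min: "\<And>c. c \<in> M \<Longrightarrow> p c \<noteq> p' c \<Longrightarrow> d b \<le> d c"
    by blast
  have "insert (p b) b \<in> parent_tree M p'"
    unfolding eq[symmetric] using b(1) by (auto simp: parent_tree_def)
  then obtain c where c: "c \<in> M" "insert (p b) b = insert (p' c) c"
    unfolding parent_tree_def by auto
  show False
  proof (cases "c = b")
    case True
    then show False using c b d[of b b] d'[of b b] by auto
  next
    case False
    then have "b \<inter> c = {}" using dj b c by (auto simp: disjoint_def)
    moreover have "b \<noteq> {}" "c \<noteq> {}" using ne b c by auto
    ultimately have "p b \<in> c" "p' c \<in> b" using insert_eq_insert_disjoint[OF c(2)] by auto
    then have "d c < d b" using d b c by auto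
    with min[of c] c have "p c = p' c" by force
    with \<open>p' c \<in> b\<close> d[of c b] b c have "d b < d c" by auto
    with \<open>d c < d b\<close> show False by simp
  qed
qed

lemma parent_tree_is_spanning:
  assumes M: "finite M" "disjoint M" "{} \<notin> M" "\<And>b. b \<in> M \<Longrightarrow> card b = r" and "r \<ge> 1"
    and \<rho>: "\<rho> \<notin> \<Union>M" and p: "p \<in> parent_maps M \<rho>"
  shows "hyper_spanning_tree (r + 1) (insert \<rho> (\<Union>M)) (parent_tree M p)"
proof -
  let ?V = "insert \<rho> (\<Union>M)" and ?T = "parent_tree M p"
  let ?F = "incidence_edges ?V ?T"
  from p have pV: "\<And>b. b \<in> M \<Longrightarrow> p b \<in> ?V" by (rule parent_maps_in)
  from parent_maps_rank[OF p] obtain d :: "'a set \<Rightarrow> nat"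
    where "\<forall>b\<in>M. \<forall>b'\<in>M. p b \<in> b' \<longrightarrow> d b' < d b" ..
  then have d: "d b' < d b" if "b \<in> M" "b' \<in> M" "p b \<in> b'" for b b'
    using that by blast
  have pb: "p b \<notin> b" if "b \<in> M" for b using d[of b b] that by auto
  have fin: "finite b" if "b \<in> M" for b using M(4)[OF that] \<open>r \<ge> 1\<close> by (metis card.infinite not_one_le_zero)
  define blk where "blk v = (THE b. b \<in> M \<and> v \<in> b)" for v
  have blk: "blk v = b" if "v \<in> b" "b \<in> M" for v b
    unfolding blk_def by (rule the_equality) (use that M(2) in \<open>auto simp: disjoint_def\<close>)
  have inj: "b = b'" if "b \<in> M" "b' \<in> M" "insert (p b) b = insert (p b') b'" for b b'
  proof (rule ccontr)
    assume "b \<noteq> b'"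
    then have "b \<inter> b' = {}" using M(2) that by (auto simp: disjoint_def)
    moreover have "b \<noteq> {}" "b' \<noteq> {}" using M(3) that by auto
    ultimately have "p b \<in> b'" "p b' \<in> b" using insert_eq_insert_disjoint[OF that(3)] by auto
    then show False using d[of b b'] d[of b' b] that by simp
  qed
  define own where "own e = (THE b. b \<in> M \<and> e = insert (p b) b)" for e
  have own: "own (insert (p b) b) = b" if "b \<in> M" for b
    unfolding own_def by (rule the_equality) (use that inj in auto)
  \<comment> \<open>The tree hangs from the root: a vertex has the hyperedge of its block as parent,
    and a hyperedge has \<open>p b\<close>. Hyperedges get odd ranks and vertices even ones, so that
    the hyperedge of \<open>b\<close> fits between its attaching vertex and the vertices of
    \<open>b\<close>.\<close>
  define par where "par = case_sum (\<lambda>v. Inr (insert (p (blk v)) (blk v)) :: 'a + 'a set) (\<lambda>e. Inl (p (own e)))"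
  define rk where "rk = case_sum (\<lambda>v. if v = \<rho> then 0 else 2 * d (blk v) + 2) (\<lambda>e. 2 * d (own e) + 1)"
  have edge: "(y = par x \<and> rk y < rk x) \<or> (x = par y \<and> rk x < rk y)" if vb: "v \<in> insert (p b) b" "b \<in> M"
    "x = Inl v" "y = Inr (insert (p b) b)" for x y v b
  proof (cases "v \<in> b")
    case True
    then have "v \<noteq> \<rho>" using \<rho> vb by auto
    then show ?thesis using vb True by (auto simp: par_def rk_def own blk)
  next
    case False
    then have "v = p b" using vb by auto
    moreover have "d (blk v) < d b" if "v \<noteq> \<rho>"
    proof -
      from that pV[OF vb(2)] \<open>v = p b\<close> obtain b' where "b' \<in> M" "p b \<in> b'" by auto
      then show ?thesis using d[OF vb(2)] blk \<open>v = p b\<close> by auto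
    qed
    ultimately show ?thesis using vb by (auto simp: par_def rk_def own)
  qed
  have acyc: "\<not> graph_cycle ?F xs" for xs
  proof (rule no_graph_cycle_if_parent[of _ par rk])
    fix x y assume "{x, y} \<in> ?F"
    then obtain v b where "{x, y} = {Inl v, Inr (insert (p b) b)}" "v \<in> insert (p b) b" "b \<in> M"
      unfolding incidence_edges_def parent_tree_def by auto
    then show "(y = par x \<and> rk y < rk x) \<or> (x = par y \<and> rk x < rk y)"
      using edge[of v b x y] edge[of v b y x] by (auto simp: doubleton_eq_iff)
  qed
  let ?R = "{(a, b). {a, b} \<in> ?F}\<^sup>*"
  have sym: "(x, y) \<in> ?R \<Longrightarrow> (y, x) \<in> ?R" for x y
    by (rule symD[OF sym_rtrancl]) (auto simp: sym_def insert_commute)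
  have ed: "(Inl v, Inr (insert (p b) b)) \<in> ?R" if "v \<in> insert (p b) b" "b \<in> M" for v b
  proof (rule r_into_rtrancl)
    have "v \<in> ?V" using that pV[OF that(2)] by blast
    moreover have "insert (p b) b \<in> ?T" using that by (simp add: parent_tree_def)
    ultimately show "(Inl v, Inr (insert (p b) b)) \<in> {(a, b). {a, b} \<in> ?F}"
      unfolding incidence_edges_def using that(1) by blast
  qed
  have reach: "(Inr (insert (p b) b), Inl \<rho>) \<in> ?R" if "b \<in> M" for b
    using that
  proof (induction "d b" arbitrary: b rule: less_induct)
    case less
    have 1: "(Inr (insert (p b) b), Inl (p b)) \<in> ?R" using less.prems ed sym by blast
    show ?case
    proof (cases "p b = \<rho>")
      case True then show ?thesis using 1 by simp
    next
      case False
      then obtain b' where b': "b' \<in> M" "p b \<in> b'" using pV less.prems by blast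
      have "(Inl (p b), Inr (insert (p b') b')) \<in> ?R" using ed b' by blast
      then show ?thesis using 1 less.hyps[of b'] d b' less.prems by (meson rtrancl_trans)
    qed
  qed
  have reach': "(x, Inl \<rho>) \<in> ?R" if "x \<in> ?V <+> ?T" for x
    using that
  proof
    fix v assume v: "v \<in> ?V" "x = Inl v"
    show ?thesis
    proof (cases "v = \<rho>")
      case False
      then obtain b where "b \<in> M" "v \<in> b" using v by blast
      then show ?thesis using ed[of v b] reach v by (auto intro: rtrancl_trans)
    qed (use v in auto)
  next
    fix e assume "e \<in> ?T" "x = Inr e"
    then show ?thesis using reach by (auto simp: parent_tree_def)
  qed
  have "graph_connected (?V <+> ?T) ?F"
    unfolding graph_connected_def
  proof (intro conjI ballI)
    show "?V <+> ?T \<noteq> {}" by auto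
    show "(x, y) \<in> ?R" if "x \<in> ?V <+> ?T" "y \<in> ?V <+> ?T" for x y
      using reach'[OF that(1)] sym[OF reach'[OF that(2)]] by (rule rtrancl_trans)
  qed
  moreover have "e \<subseteq> ?V \<and> card e = r + 1" if "e \<in> ?T" for e
  proof -
    from that obtain b where "b \<in> M" "e = insert (p b) b" by (auto simp: parent_tree_def)
    then show ?thesis using pV[of b] pb[of b] fin[of b] M(4)[of b] by auto
  qed
  ultimately show ?thesis
    unfolding hyper_spanning_tree_def graph_tree_def using acyc by blast
qed

lemma tree_matching_parent_tree:
  assumes M: "finite M" "disjoint M" "{} \<notin> M" "\<And>b. b \<in> M \<Longrightarrow> card b = r" and "r \<ge> 1"
    and \<rho>: "\<rho> \<notin> \<Union>M" and p: "p \<in> parent_maps M \<rho>"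
  shows "tree_matching r \<rho> (parent_tree M p) = M"
proof -
  let ?T = "parent_tree M p"
  from p have pV: "\<And>b. b \<in> M \<Longrightarrow> p b \<in> insert \<rho> (\<Union>M)" by (rule parent_maps_in)
  from parent_maps_rank[OF p] obtain d :: "'a set \<Rightarrow> nat"
    where "\<forall>b\<in>M. \<forall>b'\<in>M. p b \<in> b' \<longrightarrow> d b' < d b" ..
  then have d: "d b' < d b" if "b \<in> M" "b' \<in> M" "p b \<in> b'" for b b'
    using that by blast
  have pb: "p b \<notin> b" if "b \<in> M" for b using d[of b b] that by auto
  have fin: "finite b" if "b \<in> M" for b using M(4)[OF that] \<open>r \<ge> 1\<close> by (metis card.infinite not_one_le_zero)
  define S where "S n = (matching_step r \<rho> ^^ n) (?T, {})" for n
  \<comment> \<open>\<open>d b + 1\<close> steps suffice to find \<open>b\<close>: by then the block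
    containing \<open>p b\<close>, which has smaller rank, has been found.\<close>
  have inv: "fst (S n) = (\<lambda>b. insert (p b) b) ` (M - snd (S n)) \<and> snd (S n) \<subseteq> M \<and>
    (\<forall>b\<in>M. d b < n \<longrightarrow> b \<in> snd (S n))" for n
  proof (induction n)
    case 0
    then show ?case by (auto simp: S_def parent_tree_def)
  next
    case (Suc n)
    define B where "B = snd (S n)"
    define D where "D = insert \<rho> (\<Union>B)"
    define W where "W = {e \<in> fst (S n). card (e - D) = r}"
    have BM: "B \<subseteq> M" and fU: "fst (S n) = (\<lambda>b. insert (p b) b) ` (M - B)"
      and dB: "\<And>b. b \<in> M \<Longrightarrow> d b < n \<Longrightarrow> b \<in> B" using Suc by (auto simp: B_def)
    have S': "S (Suc n) = (fst (S n) - W, B \<union> (\<lambda>e. e - D) ` W)"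
      by (simp add: S_def matching_step_def Let_def B_def D_def W_def split: prod.split)
    \<comment> \<open>A block not yet found is disjoint from \<open>D\<close>, so its hyperedge can
      lose \<open>p b\<close> only: it drops to size \<open>r\<close> exactly when
      \<open>p b\<close> is deleted, and \<open>b\<close> remains.\<close>
    have bD: "b \<inter> D = {}" if "b \<in> M - B" for b
    proof -
      have "b \<inter> b' = {}" if "b' \<in> B" for b'
        using that \<open>b \<in> M - B\<close> BM M(2) by (metis DiffD1 DiffD2 disjointD in_mono)
      then show ?thesis using that \<rho> by (auto simp: D_def)
    qed
    have diff: "insert (p b) b - D = (if p b \<in> D then b else insert (p b) b)" if "b \<in> M - B" for b
      using bD[OF that] by auto
    have cW: "card (insert (p b) b - D) = r \<longleftrightarrow> p b \<in> D" if "b \<in> M - B" for b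
      using that diff[OF that] M(4) pb fin by auto
    define N where "N = {b \<in> M - B. p b \<in> D}"
    have W: "W = (\<lambda>b. insert (p b) b) ` N"
      unfolding W_def N_def fU using cW by auto
    have imW: "(\<lambda>e. e - D) ` W = N"
    proof -
      have "(\<lambda>b. insert (p b) b - D) ` N = (\<lambda>b. b) ` N"
      proof (rule image_cong[OF refl])
        fix b assume "b \<in> N"
        then have "b \<in> M - B" "p b \<in> D" by (simp_all add: N_def)
        then show "insert (p b) b - D = b" using diff[of b] by (simp only: if_True)
      qed
      then show ?thesis by (simp add: W image_image)
    qed
    have notW: "insert (p b) b \<in> W \<longleftrightarrow> b \<in> N" if "b \<in> M - B" for b
      using cW[OF that] that by (simp add: W_def N_def fU)
    have 1: "fst (S (Suc n)) = (\<lambda>b. insert (p b) b) ` (M - snd (S (Suc n)))"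
      unfolding S' imW fst_conv snd_conv fU using notW by auto
    have 2: "snd (S (Suc n)) \<subseteq> M" unfolding S' imW using BM by (auto simp: N_def)
    have "b \<in> snd (S (Suc n))" if bM: "b \<in> M" "d b < Suc n" for b
    proof -
      have "p b \<in> D"
      proof (cases "p b = \<rho>")
        case False
        then obtain b' where b': "b' \<in> M" "p b \<in> b'" using pV[OF bM(1)] by blast
        then have "d b' < n" using d[OF bM(1) b'] bM by simp
        then show ?thesis using dB b' by (auto simp: D_def)
      qed (simp add: D_def)
      then show ?thesis unfolding S' imW using bM by (auto simp: N_def)
    qed
    with 1 2 show ?case by blast
  qed
  have "tree_matching r \<rho> ?T = (\<Union>n. snd (S n))" by (simp add: tree_matching_def S_def)
  also have "\<dots> = M" using inv by blast
  finally show ?thesis .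
qed

text \<open>The stage at which a block appears is its rank, and the single vertex deleted from its
  hyperedge by then is its parent; that vertex is the root or was matched at an earlier
  stage.\<close>

lemma spanning_tree_is_parent_tree:
  assumes M: "disjoint M" "{} \<notin> M" "\<And>b. b \<in> M \<Longrightarrow> card b = r" "finite M" and "r \<ge> 1"
    and \<rho>: "\<rho> \<notin> \<Union>M" and T: "hyper_spanning_tree (r + 1) (insert \<rho> (\<Union>M)) T"
    and TM: "tree_matching r \<rho> T = M"
  shows "\<exists>p \<in> parent_maps M \<rho>. parent_tree M p = T"
proof -
  let ?V = "insert \<rho> (\<Union>M)"
  have Tc: "e \<subseteq> ?V \<and> card e = r + 1" if "e \<in> T" for e
    using T that by (auto simp: hyper_spanning_tree_def)
  define S where "S n = (matching_step r \<rho> ^^ n) (T, {})" for n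
  have MS: "M = (\<Union>n. snd (S n))" using TM by (simp add: tree_matching_def S_def)
  have SuS: "S (Suc n) = (let U = fst (S n); B = snd (S n); D = insert \<rho> (\<Union>B); W = {e \<in> U. card (e - D) = r}
     in (U - W, B \<union> (\<lambda>e. e - D) ` W))" for n
    by (simp add: S_def matching_step_def Let_def split: prod.split)
  have fT: "fst (S n) \<subseteq> T" for n
    by (induction n) (auto simp: SuS Let_def S_def[of 0])
  define d where "d b = (LEAST n. b \<in> snd (S n))" for b
  have dS: "b \<in> snd (S (d b))" if "b \<in> M" for b
    unfolding d_def by (rule LeastI_ex) (use that MS in auto)
  have dle: "d b \<le> n" if "b \<in> snd (S n)" for b n
    unfolding d_def by (rule Least_le) (rule that)
  have ex: "\<exists>v. v \<in> ?V \<and> insert v b \<in> T \<and> (\<forall>b'\<in>M. v \<in> b' \<longrightarrow> d b' < d b)" if b: "b \<in> M" for b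
  proof -
    \<comment> \<open>The procedure starts without blocks, so \<open>b\<close> is produced by the
      step that leads from stage \<open>n\<close> to stage \<open>d b = Suc n\<close>.\<close>
    have "d b \<noteq> 0" using dS[OF b] by (auto simp: S_def intro: gr0I)
    then obtain n where n: "d b = Suc n" by (cases "d b") auto
    have nb: "b \<notin> snd (S n)" using dle[of b n] n by auto
    define D where "D = insert \<rho> (\<Union>(snd (S n)))"
    obtain e where e: "e \<in> fst (S n)" "card (e - D) = r" "b = e - D"
      using dS[OF b] nb unfolding n SuS D_def Let_def by auto
    have eT: "e \<in> T" using e fT by auto
    have "finite e" using Tc[OF eT] by (metis card.infinite Suc_eq_plus1 nat.distinct(1))
    then have "card (e \<inter> D) = 1"
      using card_Int_Diff[of e D] Tc[OF eT] e by simp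
    then obtain v where v: "e \<inter> D = {v}" by (auto simp: card_1_singleton_iff)
    have "insert v b = e" using v e(3) by auto
    moreover have "d b' < d b" if "b' \<in> M" "v \<in> b'" for b'
    proof -
      have "v \<in> D" "v \<noteq> \<rho>" using v that \<rho> by auto
      then obtain b'' where b'': "b'' \<in> snd (S n)" "v \<in> b''" by (auto simp: D_def)
      then have "b'' \<in> M" using MS by auto
      with b'' that M(1) have "b' = b''" by (auto simp: disjoint_def)
      then show ?thesis using dle[of b' n] b'' n by simp
    qed
    ultimately show ?thesis using eT Tc[OF eT] v by (intro exI[of _ v]) auto
  qed
  then obtain p0 where p0: "\<And>b. b \<in> M \<Longrightarrow> p0 b \<in> ?V \<and> insert (p0 b) b \<in> T \<and> (\<forall>b'\<in>M. p0 b \<in> b' \<longrightarrow> d b' < d b)"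
    by metis
  define p where "p = restrict p0 M"
  have p: "p \<in> parent_maps M \<rho>" unfolding parent_maps_def
    using p0 by (auto simp: p_def intro!: exI[of _ d])
  have sub: "parent_tree M p \<subseteq> T" using p0 by (auto simp: parent_tree_def p_def)
  moreover have "T \<subseteq> parent_tree M p"
  proof (rule ccontr)
    assume "\<not> ?thesis"
    then obtain e where e: "e \<in> T" "e \<notin> parent_tree M p" by blast
    have "card e \<ge> 2" using Tc[OF e(1)] \<open>r \<ge> 1\<close> by simp
    then obtain u v where uv: "u \<in> e" "v \<in> e" "u \<noteq> v"
      by (meson card_2_iff' ex_card subset_iff)
    have uV: "u \<in> ?V" "v \<in> ?V" using uv Tc[OF e(1)] by auto
    let ?F = "incidence_edges ?V (parent_tree M p)" and ?G = "incidence_edges ?V T"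
    have FG: "?F \<subseteq> ?G" using sub by (auto simp: incidence_edges_def)
    have "graph_connected (?V <+> parent_tree M p) ?F"
      using parent_tree_is_spanning[OF M(4,1-3) \<open>r \<ge> 1\<close> \<rho> p]
      by (simp add: hyper_spanning_tree_def graph_tree_def)
    then have "(Inl u, Inl v) \<in> {(a, b). {a, b} \<in> ?F}\<^sup>*"
      using uV unfolding graph_connected_def by (meson InlI)
    from simple_path_if_reachable[OF this] obtain xs where xs: "xs \<noteq> []" "hd xs = Inl u" "last xs = Inl v"
      "distinct xs" "successively (\<lambda>a b. {a, b} \<in> ?F) xs" by blast
    \<comment> \<open>\<open>Inr e\<close> has no neighbour in the incidence graph of the parent
      tree, so the path from \<open>u\<close> to \<open>v\<close> avoids it and can be closed
      through it.\<close>
    have neF: "{a, b} \<in> ?F \<Longrightarrow> a \<noteq> Inr e \<and> b \<noteq> Inr e" for a b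
      using e(2) by (auto simp: incidence_edges_def doubleton_eq_iff)
    have ne: "Inr e \<notin> set xs"
    proof
      assume "Inr e \<in> set xs"
      then obtain as bs where ab: "xs = as @ Inr e # bs" by (auto simp: in_set_conv_decomp)
      then have "bs \<noteq> []" using xs(3) by auto
      then obtain c cs where "bs = c # cs" by (cases bs) auto
      with xs(5) ab neF show False by (auto simp: successively_append_iff)
    qed
    have l2: "length xs \<ge> 2"
      using xs(1-3) uv(3) by (cases xs; cases "tl xs") auto
    let ?ys = "xs @ [Inr e]"
    have "graph_cycle ?G ?ys"
      unfolding graph_cycle_def
    proof (intro conjI allI impI)
      show "3 \<le> length ?ys" using l2 by simp
      show "distinct ?ys" using xs(4) ne by simp
      fix i assume i: "i < length ?ys"
      consider "Suc i < length xs" | "Suc i = length xs" | "i = length xs" using i by fastforce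
      then show "{?ys ! i, ?ys ! (Suc i mod length ?ys)} \<in> ?G"
      proof cases
        case 1
        then have "{xs ! i, xs ! Suc i} \<in> ?F" using xs(5) successively_nthD by fast
        then show ?thesis using 1 FG by (auto simp: nth_append)
      next
        case 2
        then have "xs ! i = Inl v" using xs by (metis last_conv_nth diff_Suc_1)
        then show ?thesis using 2 uv uV e by (auto simp: nth_append incidence_edges_def)
      next
        case 3
        have "xs ! 0 = Inl u" using xs by (metis hd_conv_nth)
        then show ?thesis using 3 uv uV e xs(1)
          by (auto simp: nth_append incidence_edges_def insert_commute)
      qed
    qed
    then show False using T by (auto simp: hyper_spanning_tree_def graph_tree_def)
  qed
  ultimately show ?thesis using p by blast
qed

lemma bij_betw_parent_tree:
  assumes M: "disjoint M" "{} \<notin> M" "\<And>b. b \<in> M \<Longrightarrow> card b = r" "finite M" and "r \<ge> 1" "\<rho> \<notin> \<Union>M"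
  shows "bij_betw (parent_tree M) (parent_maps M \<rho>)
    {T. hyper_spanning_tree (r + 1) (insert \<rho> (\<Union>M)) T \<and> tree_matching r \<rho> T = M}"
  unfolding bij_betw_def
  using inj_on_parent_tree[OF M(2,1)] parent_tree_is_spanning[OF M(4,1-3) assms(5,6)]
    tree_matching_parent_tree[OF M(4,1-3) assms(5,6)] spanning_tree_is_parent_tree[OF assms]
  by fast

section \<open>Regions as classes of agreeing points\<close>

definition shi_complement :: "nat \<Rightarrow> nat set \<Rightarrow> (nat \<Rightarrow> real) set" where
  "shi_complement r I = {x \<in> extensional I. shi_generic r I x}"

definition shi_class :: "nat \<Rightarrow> nat set \<Rightarrow> (nat \<Rightarrow> real) \<Rightarrow> (nat \<Rightarrow> real) set" where
  "shi_class r I x = {y \<in> shi_complement r I. shi_agree r I x y}"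

text \<open>For \<open>i < j\<close> the constants \<open>0..r\<close> are the offsets at
  \<open>x j\<close>; a negative constant becomes an offset at \<open>x i\<close>, of size at most
  \<open>r - 1\<close>. This is the asymmetry in \<open>shi_adm\<close>.\<close>

lemma shi_complement_eq:
  assumes "r \<ge> 1"
  shows "topspace (powertop_real {1..k}) - \<Union>(shi_arrangement r k) = shi_complement r {1..k}"
proof -
  have "x \<in> \<Union>(shi_arrangement r k) \<longleftrightarrow> \<not> shi_generic r {1..k} x" if x: "x \<in> extensional {1..k}" for x
  proof
    assume "x \<in> \<Union>(shi_arrangement r k)"
    then obtain i j c where ij: "1 \<le> i" "i < j" "j \<le> k" and c: "- int r + 1 \<le> c" "c \<le> int r"
      and eq: "x i - x j = of_int c"
      unfolding shi_arrangement_def by auto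
    show "\<not> shi_generic r {1..k} x"
    proof
      assume g: "shi_generic r {1..k} x"
      have g': "x b + real n \<noteq> x a" if "a \<in> {1..k}" "b \<in> {1..k}" "a \<noteq> b" "shi_adm r a b n" for a b n
        using g that by (simp add: shi_generic_def)
      show False
      proof (cases "c \<ge> 0")
        case True
        then have "real (nat c) = of_int c" "shi_adm r i j (nat c)"
          using c ij by (simp_all add: shi_adm_def) linarith
        then show False using g'[of i j "nat c"] ij eq by auto
      next
        case False
        then have "real (nat (- c)) = - of_int c" "nat (- c) < r" using c by simp_all
        then show False using g'[of j i "nat (- c)"] ij eq by (auto simp: shi_adm_def)
      qed
    qed
  next
    assume "\<not> shi_generic r {1..k} x"
    then obtain i l c where il: "i \<in> {1..k}" "l \<in> {1..k}" "i \<noteq> l" "shi_adm r i l c" "x l + real c = x i"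
      by (auto simp: shi_generic_def)
    have "\<exists>i j e. x i - x j = of_int e \<and> 1 \<le> i \<and> i < j \<and> j \<le> k \<and> e \<in> {- int r + 1..int r}"
    proof (cases "i < l")
      case True
      then show ?thesis using il \<open>r \<ge> 1\<close>
        by (intro exI[of _ i] exI[of _ l] exI[of _ "int c"]) (auto simp: shi_adm_def)
    next
      case False
      then show ?thesis using il
        by (intro exI[of _ l] exI[of _ i] exI[of _ "- int c"]) (auto simp: shi_adm_def)
    qed
    then obtain i j e where "x i - x j = of_int e" "1 \<le> i" "i < j" "j \<le> k" "e \<in> {- int r + 1..int r}"
      by blast
    moreover from this x have "x \<in> {x \<in> topspace (powertop_real {1..k}). x i - x j = of_int e}"
      by (simp add: PiE_def)
    ultimately show "x \<in> \<Union>(shi_arrangement r k)"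
      unfolding shi_arrangement_def by blast
  qed
  then show ?thesis by (auto simp: shi_complement_def PiE_def)
qed

text \<open>The class is cut out of the complement by finitely many open half-spaces, chosen by the
  side on which \<open>x\<close> lies.\<close>

lemma openin_shi_class:
  assumes fin: "finite I" and x: "x \<in> shi_complement r I"
  shows "openin (subtopology (powertop_real I) (shi_complement r I)) (shi_class r I x)"
proof -
  let ?X = "powertop_real I"
  define T where "T = {(i, l, c) \<in> I \<times> I \<times> {..r}. shi_adm r i l c \<and> i \<noteq> l}"
  define U where "U = (\<lambda>(i, l, c). {y \<in> topspace ?X. y l + real c - y i \<in>
    (if x l + real c < x i then {..<0} else {0<..})})"
  have finT: "finite T" by (rule finite_subset[of _ "I \<times> I \<times> {..r}"]) (use fin in \<open>auto simp: T_def\<close>)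
  have openU: "openin ?X (U t)" if "t \<in> T" for t
  proof -
    obtain i l c where t: "t = (i, l, c)" by (cases t) auto
    have il: "i \<in> I" "l \<in> I" using that t by (auto simp: T_def)
    have cm: "continuous_map ?X euclideanreal (\<lambda>y. y l + real c - y i)"
      by (intro continuous_map_diff continuous_map_add continuous_map_product_projection il) auto
    show ?thesis unfolding U_def t prod.case
      by (rule openin_continuous_map_preimage[OF cm]) (simp split: if_split)
  qed
  have gen: "y l + real c \<noteq> y i" if "y \<in> shi_complement r I" "(i, l, c) \<in> T" for y i l c
    using that by (auto simp: shi_complement_def shi_generic_def T_def)
  have "shi_class r I x = ((\<Inter>t\<in>T. U t) \<inter> topspace ?X) \<inter> shi_complement r I"
  proof (intro equalityI subsetI)
    fix y assume y: "y \<in> shi_class r I x"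
    then have yA: "y \<in> shi_complement r I" and ag: "shi_agree r I x y" by (auto simp: shi_class_def)
    have "y \<in> topspace ?X" using yA by (auto simp: shi_complement_def PiE_def)
    moreover have "y \<in> U (i, l, c)" if t: "(i, l, c) \<in> T" for i l c
      using shi_agreeD[OF ag, of i l c] gen[OF yA t] t \<open>y \<in> topspace ?X\<close>
      by (auto simp: U_def T_def)
    ultimately show "y \<in> ((\<Inter>t\<in>T. U t) \<inter> topspace ?X) \<inter> shi_complement r I" using yA by auto
  next
    fix y assume y: "y \<in> ((\<Inter>t\<in>T. U t) \<inter> topspace ?X) \<inter> shi_complement r I"
    have "x l + real c < x i \<longleftrightarrow> y l + real c < y i" if il: "i \<in> I" "l \<in> I" "shi_adm r i l c" for i l c
    proof (cases "i = l")
      case False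
      then have "(i, l, c) \<in> T" using il by (auto simp: T_def shi_adm_def)
      then have "y \<in> U (i, l, c)" using y by blast
      then show ?thesis by (auto simp: U_def split: if_splits)
    qed simp
    then show "y \<in> shi_class r I x" using y by (simp add: shi_class_def shi_agree_def)
  qed
  moreover have "openin ?X ((\<Inter>t\<in>T. U t) \<inter> topspace ?X)"
    by (rule openin_INT[OF finT openU])
  ultimately show ?thesis by (auto simp: openin_subtopology)
qed

text \<open>Each \<open>w l + real c - w i\<close> is affine in \<open>w\<close> and has the same
  strict sign at \<open>x\<close> and \<open>y\<close>, hence on the whole segment.\<close>

lemma shi_class_segment:
  assumes x: "x \<in> shi_complement r I" and y: "y \<in> shi_class r I x" and t: "0 \<le> t" "t \<le> 1"
  shows "(\<lambda>i\<in>I. (1 - t) * x i + t * y i) \<in> shi_class r I x"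
proof -
  let ?z = "\<lambda>i\<in>I. (1 - t) * x i + t * y i"
  have comb: "(1 - t) * u + t * v < 0" if "u < 0" "v < 0" for u v :: real
    using convex_bound_lt[of u 0 v "1 - t" t] that t by simp
  have *: "(?z l + real c < ?z i \<longleftrightarrow> x l + real c < x i) \<and> ?z l + real c \<noteq> ?z i"
    if il: "i \<in> I" "l \<in> I" "i \<noteq> l" "shi_adm r i l c" for i l c
  proof -
    define f where "f w = w l + real c - w i" for w :: "nat \<Rightarrow> real"
    have f: "f ?z = (1 - t) * f x + t * f y" using il by (simp add: f_def algebra_simps)
    have "f x \<noteq> 0" "f y \<noteq> 0" "f x < 0 \<longleftrightarrow> f y < 0"
      using il x y by (auto simp: f_def shi_class_def shi_complement_def shi_generic_def shi_agree_def)
    then consider "f x < 0" "f y < 0" | "- f x < 0" "- f y < 0" by linarith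
    then have "(f ?z < 0 \<longleftrightarrow> f x < 0) \<and> f ?z \<noteq> 0"
    proof cases
      case 1
      then show ?thesis using comb[of "f x" "f y"] f by simp
    next
      case 2
      then show ?thesis using comb[of "- f x" "- f y"] f by simp
    qed
    then show ?thesis by (simp add: f_def)
  qed
  have "shi_generic r I ?z" unfolding shi_generic_def using * by blast
  moreover have "shi_agree r I x ?z"
    unfolding shi_agree_def
  proof (intro ballI allI impI)
    fix i l c assume "i \<in> I" "l \<in> I" "shi_adm r i l c"
    then show "x l + real c < x i \<longleftrightarrow> ?z l + real c < ?z i" using *[of i l c] by (cases "i = l") auto
  qed
  moreover have "?z \<in> extensional I" by simp
  ultimately show ?thesis unfolding shi_class_def shi_complement_def by blast
qed

text \<open>A class is clopen, since the other classes are open too, and each of its points is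
  joined to \<open>x\<close> by a segment.\<close>

lemma connected_component_shi_complement:
  assumes fin: "finite I" and x: "x \<in> shi_complement r I"
  shows "connected_component_of_set (subtopology (powertop_real I) (shi_complement r I)) x = shi_class r I x"
proof -
  let ?A = "shi_complement r I"
  let ?T = "subtopology (powertop_real I) ?A"
  have top: "topspace ?T = ?A" by (auto simp: shi_complement_def PiE_def)
  have xx: "x \<in> shi_class r I x" using x by (simp add: shi_class_def shi_agree_def)
  have "openin ?T (?A - shi_class r I x)"
  proof -
    have "?A - shi_class r I x = (\<Union>y\<in>?A - shi_class r I x. shi_class r I y)"
    proof (intro equalityI subsetI)
      fix y assume "y \<in> ?A - shi_class r I x"
      then show "y \<in> (\<Union>y\<in>?A - shi_class r I x. shi_class r I y)"
        by (auto simp: shi_class_def shi_agree_def)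
    next
      fix z assume "z \<in> (\<Union>y\<in>?A - shi_class r I x. shi_class r I y)"
      then obtain y where y: "\<not> shi_agree r I x y" "z \<in> ?A" "shi_agree r I y z"
        by (auto simp: shi_class_def)
      then have "\<not> shi_agree r I x z" using shi_agree_trans[OF _ shi_agree_sym[OF y(3)]] by blast
      then show "z \<in> ?A - shi_class r I x" using y(2) by (simp add: shi_class_def)
    qed
    moreover have "openin ?T (\<Union>y\<in>?A - shi_class r I x. shi_class r I y)"
      by (intro openin_Union) (auto intro: openin_shi_class[OF fin])
    ultimately show ?thesis by simp
  qed
  then have clo: "closedin ?T (shi_class r I x)"
    unfolding closedin_def top by (auto simp: shi_class_def)
  show ?thesis
  proof
    have "connected_component_of_set ?T x \<subseteq> shi_class r I x \<or>
        disjnt (connected_component_of_set ?T x) (shi_class r I x)"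
      by (rule connectedin_clopen_cases[OF connectedin_connected_component_of clo openin_shi_class[OF fin x]])
    moreover have "x \<in> connected_component_of_set ?T x"
      using x top by (simp add: connected_component_of_refl)
    ultimately show "connected_component_of_set ?T x \<subseteq> shi_class r I x"
      using xx by (auto simp: disjnt_iff)
  next
    show "shi_class r I x \<subseteq> connected_component_of_set ?T x"
    proof
      fix y assume y: "y \<in> shi_class r I x"
      define g where "g t = (\<lambda>i\<in>I. (1 - t) * x i + t * y i)" for t :: real
      let ?S = "top_of_set {0..1::real}"
      have gA: "g t \<in> shi_class r I x" if "t \<in> {0..1}" for t
        using shi_class_segment[OF x y, of t] that by (simp add: g_def)
      have "continuous_map ?S (powertop_real I) g"
        unfolding continuous_map_componentwise
      proof (intro conjI ballI)
        show "g ` topspace ?S \<subseteq> extensional I" by (auto simp: g_def)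
        fix i assume "i \<in> I"
        then show "continuous_map ?S euclideanreal (\<lambda>t. g t i)"
          by (auto simp: g_def intro!: continuous_intros)
      qed
      then have "continuous_map ?S ?T g"
        using gA by (auto simp: continuous_map_in_subtopology shi_class_def)
      then have "connectedin ?T (g ` {0..1})"
        by (rule connectedin_continuous_map_image) (simp add: connectedin_subtopology)
      moreover have "g 0 = x" "g 1 = y"
        using x y by (auto simp: g_def shi_class_def shi_complement_def extensional_def fun_eq_iff)
      then have "x \<in> g ` {0..1}" "y \<in> g ` {0..1}" by (auto intro: rev_image_eqI)
      ultimately show "y \<in> connected_component_of_set ?T x"
        unfolding connected_component_of_def by blast
    qed
  qed
qed

lemma regions_eq_shi_classes:
  assumes "r \<ge> 1"
  shows "regions k (shi_arrangement r k) = shi_class r {1..k} ` shi_complement r {1..k}"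
proof -
  have "topspace (subtopology (powertop_real {1..k}) (shi_complement r {1..k})) = shi_complement r {1..k}"
    by (auto simp: shi_complement_def PiE_def)
  then show ?thesis
    unfolding regions_def shi_complement_eq[OF assms] connected_components_of_def
    using connected_component_shi_complement[of "{1..k}"] by (intro image_cong) auto
qed

lemma bij_betw_shi_classes:
  assumes fin: "finite I" and r: "r \<ge> 1"
  shows "\<exists>f. bij_betw f (slot_maps r I) (shi_class r I ` shi_complement r I)"
proof -
  from slot_maps_represent_classes[OF assms] obtain X
    where gen: "\<forall>s\<in>slot_maps r I. shi_generic r I (X s)"
    and inj: "\<forall>s\<in>slot_maps r I. \<forall>s'\<in>slot_maps r I. shi_agree r I (X s) (X s') \<longrightarrow> s = s'"
    and surj: "\<forall>x. shi_generic r I x \<longrightarrow> (\<exists>s\<in>slot_maps r I. shi_agree r I x (X s))"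
    by (elim exE conjE)
  \<comment> \<open>Points of the product space are undefined outside \<open>I\<close>; the
    restriction changes no comparison within \<open>I\<close>.\<close>
  define Y where "Y s = restrict (X s) I" for s
  have YA: "Y s \<in> shi_complement r I" if "s \<in> slot_maps r I" for s
    using bspec[OF gen that] by (simp add: Y_def shi_complement_def shi_generic_def)
  have agY: "shi_agree r I x (Y s) \<longleftrightarrow> shi_agree r I x (X s)"
    "shi_agree r I (Y s) x \<longleftrightarrow> shi_agree r I (X s) x" for x s
    by (simp_all add: Y_def shi_agree_def)
  have "inj_on (\<lambda>s. shi_class r I (Y s)) (slot_maps r I)"
  proof (rule inj_onI)
    fix s s' assume s: "s \<in> slot_maps r I" "s' \<in> slot_maps r I" "shi_class r I (Y s) = shi_class r I (Y s')"
    have "Y s' \<in> shi_class r I (Y s')" using YA[OF s(2)] by (simp add: shi_class_def shi_agree_def)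
    then have "shi_agree r I (Y s) (Y s')" using s(3) by (auto simp: shi_class_def)
    then show "s = s'" using inj s(1,2) agY by simp
  qed
  moreover have "(\<lambda>s. shi_class r I (Y s)) ` slot_maps r I = shi_class r I ` shi_complement r I"
  proof (intro equalityI subsetI)
    fix C assume "C \<in> shi_class r I ` shi_complement r I"
    then obtain x where x: "x \<in> shi_complement r I" "C = shi_class r I x" by blast
    then obtain s where s: "s \<in> slot_maps r I" "shi_agree r I x (Y s)"
      using spec[OF surj, of x] agY by (auto simp: shi_complement_def)
    have "shi_class r I x = shi_class r I (Y s)"
      using s(2) by (auto simp: shi_class_def shi_agree_def)
    then show "C \<in> (\<lambda>s. shi_class r I (Y s)) ` slot_maps r I" using s(1) x(2) by blast
  qed (use YA in blast)
  ultimately show ?thesis unfolding bij_betw_def by blast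
qed

section \<open>Labels as vertices, and the comparison of the counts\<close>

text \<open>With the blocks numbered by \<open>\<beta>\<close> and the vertices of each block by
  \<open>\<gamma>\<close>, a label is a vertex. As \<open>(j, c)\<close> names a vertex of the block
  \<open>\<beta> j\<close>, ranks of indices and ranks of blocks carry over to each other.\<close>

lemma bij_betw_label_maps_parent_maps:
  assumes \<beta>: "bij_betw \<beta> I M" and dj: "disjoint M" and card: "\<And>b. b \<in> M \<Longrightarrow> finite b \<and> card b = r"
    and \<rho>: "\<rho> \<notin> \<Union>M"
  shows "\<exists>f. bij_betw f (label_maps r I) (parent_maps M \<rho>)"
proof -
  have "\<exists>h. bij_betw h {..<r} b" if "b \<in> M" for b
    using ex_bij_betw_nat_finite[of b] card[OF that] by (auto simp: lessThan_atLeast0)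
  then obtain \<gamma> where \<gamma>: "\<And>b. b \<in> M \<Longrightarrow> bij_betw (\<gamma> b) {..<r} b" by metis
  have \<beta>M: "\<beta> i \<in> M" if "i \<in> I" for i using \<beta> that by (auto simp: bij_betw_def)
  have \<beta>eq: "i = j" if "i \<in> I" "j \<in> I" "v \<in> \<beta> i" "v \<in> \<beta> j" for i j v
  proof -
    have "\<beta> i = \<beta> j" using dj \<beta>M[OF that(1)] \<beta>M[OF that(2)] that(3,4) by (auto simp: disjoint_def)
    then show ?thesis using \<beta> that(1,2) by (auto simp: bij_betw_def dest: inj_onD)
  qed
  define vert where "vert p = (case p of None \<Rightarrow> \<rho> | Some (j, c) \<Rightarrow> \<gamma> (\<beta> j) c)" for p
  let ?D = "insert None (Some ` (I \<times> {..<r}))"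
  have vin: "vert (Some (j, c)) \<in> \<beta> j" if "j \<in> I" "c < r" for j c
    using \<gamma>[OF \<beta>M[OF that(1)]] that(2) by (auto simp: vert_def bij_betw_def)
  have vroot: "vert (Some (j, c)) \<noteq> \<rho>" if "j \<in> I" "c < r" for j c
    using vin[OF that] \<beta>M[OF that(1)] \<rho> by auto
  have vinj: "inj_on vert ?D"
  proof (rule inj_onI)
    fix p q assume pq: "p \<in> ?D" "q \<in> ?D" "vert p = vert q"
    show "p = q"
    proof (cases p)
      case None
      then show ?thesis using pq vroot by (cases q) (auto simp: vert_def)
    next
      case (Some a)
      then obtain j c where p: "p = Some (j, c)" "j \<in> I" "c < r" using pq(1) by auto
      have "q \<noteq> None"
      proof
        assume "q = None"
        then have "vert q = \<rho>" by (simp add: vert_def)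
        then show False using pq(3) vroot[OF p(2,3)] p(1) by simp
      qed
      then obtain l d where q: "q = Some (l, d)" "l \<in> I" "d < r" using pq(2) by auto
      have "j = l" using \<beta>eq[OF p(2) q(2) vin[OF p(2,3)]] vin[OF q(2,3)] pq(3) p(1) q(1) by simp
      moreover from this have "\<gamma> (\<beta> j) c = \<gamma> (\<beta> j) d" using pq(3) p(1) q(1) by (simp add: vert_def)
      then have "c = d" using \<gamma>[OF \<beta>M[OF p(2)]] p(3) q(3) by (auto simp: bij_betw_def dest: inj_onD)
      ultimately show ?thesis using p q by simp
    qed
  qed
  have vsurj: "\<exists>p\<in>?D. vert p = v" if v: "v \<in> insert \<rho> (\<Union>M)" for v
  proof (cases "v = \<rho>")
    case True
    then show ?thesis by (intro bexI[of _ None]) (auto simp: vert_def)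
  next
    case False
    then obtain b where b: "b \<in> M" "v \<in> b" using v by blast
    obtain j where j: "j \<in> I" "b = \<beta> j" using \<beta> b(1) by (auto simp: bij_betw_def)
    obtain c where "c < r" "v = \<gamma> b c" using \<gamma>[OF b(1)] b(2) by (auto simp: bij_betw_def)
    then show ?thesis using j by (intro bexI[of _ "Some (j, c)"]) (auto simp: vert_def)
  qed
  define \<alpha> where "\<alpha> = inv_into I \<beta>"
  have \<alpha>\<beta>: "\<alpha> (\<beta> i) = i" if "i \<in> I" for i
    using \<beta> that by (simp add: \<alpha>_def bij_betw_def)
  have \<alpha>: "\<alpha> b \<in> I \<and> \<beta> (\<alpha> b) = b" if "b \<in> M" for b
    using \<beta> that by (auto simp: \<alpha>_def bij_betw_def f_inv_into_f inv_into_into)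
  define \<Phi> where "\<Phi> q = (\<lambda>b\<in>M. vert (q (\<alpha> b)))" for q
  have qD: "q i \<in> ?D" if "q \<in> label_maps r I" "i \<in> I" for q i
    using label_mapsD[OF that] by (cases "q i") auto
  have \<Phi>in: "\<Phi> q \<in> parent_maps M \<rho>" if q: "q \<in> label_maps r I" for q
  proof -
    from q obtain d :: "nat \<Rightarrow> nat" where d: "\<And>i j c. \<lbrakk>i \<in> I; q i = Some (j, c)\<rbrakk> \<Longrightarrow> d j < d i"
      unfolding label_maps_def by blast
    have "vert (q (\<alpha> b)) \<in> insert \<rho> (\<Union>M)" if "b \<in> M" for b
    proof (cases "q (\<alpha> b)")
      case (Some a)
      obtain j c where a: "a = (j, c)" by (cases a)
      then show ?thesis using vin[of j c] label_mapsD[OF q, of "\<alpha> b" j c] Some \<alpha>[OF that] \<beta>M[of j] by auto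
    qed (simp add: vert_def)
    moreover have "d (\<alpha> b') < d (\<alpha> b)" if b: "b \<in> M" "b' \<in> M" "vert (q (\<alpha> b)) \<in> b'" for b b'
    proof -
      have "q (\<alpha> b) \<noteq> None"
      proof
        assume "q (\<alpha> b) = None"
        then show False using b \<rho> by (auto simp: vert_def)
      qed
      then obtain j c where jc: "q (\<alpha> b) = Some (j, c)" by auto
      have j: "j \<in> I" "c < r" using label_mapsD[OF q _ jc] \<alpha>[OF b(1)] by auto
      have "j = \<alpha> b'" using \<beta>eq[OF j(1) _ vin[OF j]] \<alpha>[OF b(2)] b(3) jc by simp
      then show ?thesis using d[OF _ jc] \<alpha>[OF b(1)] by simp
    qed
    ultimately show ?thesis
      unfolding parent_maps_def \<Phi>_def by (auto intro!: exI[of _ "\<lambda>b. d (\<alpha> b)"])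
  qed
  have inj: "inj_on \<Phi> (label_maps r I)"
  proof (rule inj_onI)
    fix q q' assume q: "q \<in> label_maps r I" "q' \<in> label_maps r I" "\<Phi> q = \<Phi> q'"
    have "q i = q' i" if i: "i \<in> I" for i
    proof -
      have "\<Phi> q (\<beta> i) = \<Phi> q' (\<beta> i)" using q(3) by simp
      then have "vert (q i) = vert (q' i)" using \<beta>M[OF i] \<alpha>\<beta>[OF i] by (simp add: \<Phi>_def)
      then show ?thesis using inj_onD[OF vinj] qD[OF q(1) i] qD[OF q(2) i] by blast
    qed
    then show "q = q'" using q by (intro extensionalityI[of _ I]) (auto simp: label_maps_def)
  qed
  have surj: "\<exists>q\<in>label_maps r I. \<Phi> q = p" if p: "p \<in> parent_maps M \<rho>" for p
  proof -
    from parent_maps_rank[OF p] obtain d :: "'a set \<Rightarrow> nat"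
      where d: "\<forall>b\<in>M. \<forall>b'\<in>M. p b \<in> b' \<longrightarrow> d b' < d b" ..
    have "\<exists>u\<in>?D. vert u = p (\<beta> i)" if "i \<in> I" for i
      using vsurj[OF parent_maps_in[OF p \<beta>M[OF that]]] .
    then obtain q0 where q0: "\<And>i. i \<in> I \<Longrightarrow> q0 i \<in> ?D \<and> vert (q0 i) = p (\<beta> i)" by metis
    define q where "q = restrict q0 I"
    have "j \<in> I \<and> c < r \<and> d (\<beta> j) < d (\<beta> i)" if i: "i \<in> I" "q i = Some (j, c)" for i j c
    proof -
      have jc: "j \<in> I" "c < r" "p (\<beta> i) = vert (Some (j, c))" using q0[OF i(1)] i by (auto simp: q_def)
      then show ?thesis using d \<beta>M[OF i(1)] \<beta>M[OF jc(1)] vin[OF jc(1,2)] by simp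
    qed
    then have "q \<in> label_maps r I"
      unfolding label_maps_def by (auto simp: q_def intro!: exI[of _ "\<lambda>i. d (\<beta> i)"])
    moreover have "\<Phi> q = p"
    proof (rule extensionalityI[of _ M])
      show "\<Phi> q \<in> extensional M" "p \<in> extensional M" using p by (auto simp: \<Phi>_def parent_maps_def PiE_def)
      fix b assume "b \<in> M"
      then show "\<Phi> q b = p b" using \<alpha>[of b] q0[of "\<alpha> b"] by (simp add: \<Phi>_def q_def)
    qed
    ultimately show ?thesis by blast
  qed
  have "bij_betw \<Phi> (label_maps r I) (parent_maps M \<rho>)"
    unfolding bij_betw_def using inj \<Phi>in surj by blast
  then show ?thesis by blast
qed

theorem theorem4:
  fixes r k :: nat and M :: "nat set set"
  assumes "r \<ge> 1" and "k \<ge> 1"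
    and "perfect_matching r {1..r * k} M"
  shows "finite (regions k (shi_arrangement r k)) \<and>
    card (regions k (shi_arrangement r k)) =
      card {T. hyper_spanning_tree (r + 1) {1..r * k + 1} T \<and> tree_matching r (r * k + 1) T = M}"
proof -
  let ?I = "{1..k}" and ?\<rho> = "r * k + 1"
  let ?L = "label_maps r ?I" and ?R = "regions k (shi_arrangement r k)"
  from assms(3) have part: "partition_on {1..r * k} M" and cM: "\<And>b. b \<in> M \<Longrightarrow> card b = r"
    by (auto simp: perfect_matching_def)
  have UM: "\<Union>M = {1..r * k}" using partition_onD1[OF part] ..
  have dj: "disjoint M" and ne: "{} \<notin> M" using partition_onD2[OF part] partition_onD3[OF part] by auto
  have finM: "finite M" using part by (rule finite_elements[rotated]) simp
  have finb: "finite b" if "b \<in> M" for b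
    by (rule finite_subset[of _ "{1..r * k}"]) (use UM that in auto)
  \<comment> \<open>The \<open>r * k\<close> vertices fill exactly \<open>k\<close> blocks, so the
    coordinates can number the blocks.\<close>
  have "r * k = (\<Sum>b\<in>M. card b)" using product_partition[OF part finb] by simp
  then have "card M = k" using cM \<open>r \<ge> 1\<close> by simp
  then obtain \<beta> where \<beta>: "bij_betw \<beta> ?I M" using ex_bij_betw_nat_finite_1[OF finM] by blast
  have \<rho>: "?\<rho> \<notin> \<Union>M" by (simp add: UM)
  have V: "insert ?\<rho> (\<Union>M) = {1..r * k + 1}" unfolding UM by auto
  have finL: "finite ?L" by (rule finite_label_maps) simp
  obtain f where f: "bij_betw f (slot_maps r ?I) ?R"
    using bij_betw_shi_classes[of ?I r] \<open>r \<ge> 1\<close> unfolding regions_eq_shi_classes[OF \<open>r \<ge> 1\<close>] by blast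
  then have LR: "bij_betw (f \<circ> chain_siblings r ?I) ?L ?R"
    using bij_betw_chain_siblings[of ?I r] by (auto intro: bij_betw_trans)
  obtain g where "bij_betw g ?L (parent_maps M ?\<rho>)"
    using bij_betw_label_maps_parent_maps[OF \<beta> dj _ \<rho>, of r] cM finb by blast
  with bij_betw_parent_tree[OF dj ne cM finM \<open>r \<ge> 1\<close> \<rho>]
  have "bij_betw (parent_tree M \<circ> g) ?L
      {T. hyper_spanning_tree (r + 1) {1..r * k + 1} T \<and> tree_matching r ?\<rho> T = M}"
    unfolding V by (rule bij_betw_trans[rotated])
  \<comment> \<open>Finiteness of the set of regions is inherited from the label maps; equal
    cardinalities alone would not give it, as \<open>card\<close> is 0 on infinite sets.\<close>
  from bij_betw_same_card[OF this] bij_betw_same_card[OF LR] bij_betw_finite[OF LR] finL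
  show ?thesis by simp
qed

end
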